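(* Let $M$ be the set of all $\varphi\in L^2(\mathbb{R}^n)=L^2(\mathbb{R}^n;\mathbb{C})$ such that $\partial_j\varphi\in L^2(\mathbb{R}^n)$ and $x_j\varphi\in L^2(\mathbb{R}^n)$ for all $1\le j\le n$. (1) Let $\varphi\in M$ satisfy $x\varphi\neq0$ and $\nabla\varphi\neq0$. Then $$\begin{aligned}n\|\varphi\|^2&=-2\operatorname{Re}(x\varphi|\nabla\varphi)\\&=\|x\varphi\|\|\nabla\varphi\|\left(2-\left\|\frac{x\varphi}{\|x\varphi\|}+\frac{\nabla\varphi}{\|\nabla\varphi\|}\right\|^2\right)\\&=\|x\varphi\|^2+\|\nabla\varphi\|^2-\|x\varphi+\nabla\varphi\|^2,\end{aligned}$$ and $$|(x\varphi|\nabla\varphi)|=\|x\varphi\|\|\nabla\varphi\|\left(1-\frac12\left\|\frac{x\varphi}{\|x\varphi\|}-[\operatorname{sgn}(x\varphi|\nabla\varphi)]\frac{\nabla\varphi}{\|\nabla\varphi\|}\right\|^2\right).$$ (2) Let $\varphi\in M$. Then the following statements are equivalent: (i) $n\|\varphi\|^2=\|x\varphi\|^2+\|\nabla\varphi\|^2$. (ii) $x\varphi=-\nabla\varphi$. (iii) There exists $\theta\in\mathbb{R}$ such that, for any $x\in\mathbb{R}^n$, $$\varphi(x)=e^{i\theta}\frac{1}{\pi^{n/4}}\|\varphi\|\exp\left(-\frac{|x|^2}{2}\right).$$ (3) Let $\varphi\in M$ satisfy $x\varphi\neq0$. Then the following statements are equivalent: (i) $n\|\varphi\|^2=2\|x\varphi\|\|\nabla\varphi\|$.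 (ii) $\|\nabla\varphi\|x\varphi=-\|x\varphi\|\nabla\varphi$. (iii) There exists $\theta\in\mathbb{R}$ such that, for any $x\in\mathbb{R}^n$, $$\varphi(x)=e^{i\theta}\left(\frac{\|\nabla\varphi\|}{\pi\|x\varphi\|}\right)^{n/4}\|\varphi\|\exp\left(-\frac{\|\nabla\varphi\|}{\|x\varphi\|}\frac{|x|^2}{2}\right).$$ (4) Let $\varphi\in M$ satisfy $x\varphi\neq0$. Then the following statements are equivalent: (i) $|(x\varphi|\nabla\varphi)|=\|x\varphi\|\|\nabla\varphi\|$. (ii) $\|\nabla\varphi\|x\varphi=[\operatorname{sgn}(x\varphi|\nabla\varphi)]\|x\varphi\|\nabla\varphi$. (iii) There exists $\theta\in\mathbb{R}$ such that, for any $x\in\mathbb{R}^n$, $$\varphi(x)=e^{i\theta}\left(-[\operatorname{Re}\operatorname{sgn}(x\varphi|\nabla\varphi)]\frac{\|\nabla\varphi\|}{\pi\|x\varphi\|}\right)^{n/4}\|\varphi\|\exp\left([\operatorname{sgn}\overline{(x\varphi|\nabla\varphi)}]\frac{\|\nabla\varphi\|}{\|x\varphi\|}\frac{|x|^2}{2}\right).$$ Here, for $\nabla\varphi\neq0$, one has $\operatorname{Re}(x\varphi|\nabla\varphi)=\operatorname{Re}\overline{(x\varphi|\nabla\varphi)}=-\frac n2\|\varphi\|^2<0$, and hence $\operatorname{Re}\operatorname{sgn}(x\varphi|\nabla\varphi)=\operatorname{Re}\operatorname{sgn}\overline{(x\varphi|\nabla\varphi)}<0$.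
   Context: Derivatives are distributional. $x\varphi$ denotes the $\mathbb{C}^n$-valued function $(x_1\varphi,\ldots,x_n\varphi)$ and $\nabla\varphi=(\partial_1\varphi,\ldots,\partial_n\varphi)$. For $\mathbb{C}^n$-valued functions the scalar product is that of $L^2(\mathbb{R}^n;\mathbb{C}^n)$: $((\varphi_1,\ldots,\varphi_n)|(\psi_1,\ldots,\psi_n))=\sum_{j=1}^n\int_{\mathbb{R}^n}\varphi_j\overline{\psi_j}\,dx$; $\|\cdot\|$ is the corresponding norm (and the $L^2(\mathbb{R}^n)$ norm for scalar functions). $|x|$ is the Euclidean length. Functions in $L^2$ are identified up to equality almost everywhere, so pointwise formulas are understood for the appropriate representative. The sign function is $\operatorname{sgn}z=z/|z|$ for $z\in\mathbb{C}\setminus\{0\}$ and $\operatorname{sgn}0=1$. *)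

theory Defs
  imports "HOL-Analysis.Analysis"
begin

text \<open>Elements of \<open>L\<^sup>2\<close> are represented by functions; equality in \<open>L\<^sup>2\<close> is
  equality almost everywhere.\<close>

abbreviation ae_eq :: "('a::euclidean_space \<Rightarrow> 'b) \<Rightarrow> ('a \<Rightarrow> 'b) \<Rightarrow> bool"  (infix "=\<^sub>a\<^sub>e" 50)
  where "f =\<^sub>a\<^sub>e g \<equiv> (AE x in lebesgue. f x = g x)"

definition L2 :: "('a::euclidean_space \<Rightarrow> 'b::euclidean_space) set"
  where "L2 = {f. f \<in> borel_measurable lebesgue \<and> integrable lebesgue (\<lambda>x. (norm (f x))\<^sup>2)}"

text \<open>Used both for scalar functions and for functions with values in \<open>\<complex>\<^sup>n\<close>, whose
  pointwise norm is the Hermitian one; \<open>l2_inner_self\<close> below shows that in the latter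
  case it is the norm of the scalar product \<open>l2_inner\<close>.\<close>

definition l2_norm :: "('a::euclidean_space \<Rightarrow> 'b::euclidean_space) \<Rightarrow> real"
  where "l2_norm f = sqrt (LINT x|lebesgue. (norm (f x))\<^sup>2)"

definition l2_inner :: "('a::euclidean_space \<Rightarrow> complex ^ 'n) \<Rightarrow> ('a \<Rightarrow> complex ^ 'n) \<Rightarrow> complex"
  where "l2_inner f g = (\<Sum>j\<in>UNIV. LINT x|lebesgue. f x $ j * cnj (g x $ j))"

lemma l2_inner_self:
  fixes f :: "'a::euclidean_space \<Rightarrow> complex ^ 'n"
  assumes "f \<in> L2"
  shows "l2_inner f f = of_real ((l2_norm f)\<^sup>2)"
proof -
  have m: "f \<in> borel_measurable lebesgue" and i: "integrable lebesgue (\<lambda>x. (norm (f x))\<^sup>2)"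
    using assms by (auto simp: L2_def)
  have mj: "(\<lambda>x. f x $ j) \<in> borel_measurable lebesgue" for j
    using measurable_compose[OF m, of "\<lambda>v. v $ j" borel]
    by (simp add: borel_measurable_continuous_onI continuous_on_component)
  have ij: "integrable lebesgue (\<lambda>x. (norm (f x $ j))\<^sup>2)" for j
  proof (rule Bochner_Integration.integrable_bound[OF i])
    show "(\<lambda>x. (norm (f x $ j))\<^sup>2) \<in> borel_measurable lebesgue"
      using mj by measurable
    show "AE x in lebesgue. norm ((norm (f x $ j))\<^sup>2) \<le> norm ((norm (f x))\<^sup>2)"
      by (auto intro!: AE_I2 power_mono Finite_Cartesian_Product.norm_nth_le)
  qed
  have "l2_inner f f = (\<Sum>j\<in>UNIV. of_real (LINT x|lebesgue. (norm (f x $ j))\<^sup>2))"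
    by (simp only: l2_inner_def complex_norm_square[symmetric] integral_complex_of_real)
  also have "\<dots> = of_real (LINT x|lebesgue. (\<Sum>j\<in>UNIV. (norm (f x $ j))\<^sup>2))"
    using ij by (simp add: Bochner_Integration.integral_sum)
  also have "(\<lambda>x. \<Sum>j\<in>UNIV. (norm (f x $ j))\<^sup>2) = (\<lambda>x. (norm (f x))\<^sup>2)"
    by (simp add: norm_vec_def L2_set_def sum_nonneg)
  finally show ?thesis
    by (simp add: l2_norm_def)
qed

definition partial :: "'n \<Rightarrow> (real ^ 'n \<Rightarrow> 'b::real_normed_vector) \<Rightarrow> real ^ 'n \<Rightarrow> 'b"
  where "partial j f x = frechet_derivative f (at x) (axis j 1)"

text \<open>Total differentiability, automatic once the partial derivatives exist and are
  continuous, is demanded at each step because \<^const>\<open>partial\<close> is the genuine partial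
  derivative only where the Frechet derivative exists.\<close>

primrec C_k :: "nat \<Rightarrow> (real ^ 'n \<Rightarrow> 'b::real_normed_vector) \<Rightarrow> bool"
  where
    "C_k 0 f \<longleftrightarrow> continuous_on UNIV f"
  | "C_k (Suc k) f \<longleftrightarrow> (\<forall>x. f differentiable (at x)) \<and> (\<forall>j. C_k k (partial j f))"

definition test_functions :: "(real ^ 'n \<Rightarrow> complex) set"
  where "test_functions = {\<psi>. (\<forall>k. C_k k \<psi>) \<and> compact (closure {x. \<psi> x \<noteq> 0})}"

text \<open>The distribution \<open>\<partial>\<^sub>j f\<close> is represented by the function \<open>g\<close>.  Meaningful only for locally
  integrable \<open>f\<close> and \<open>g\<close>; below both are in \<open>L\<^sup>2\<close>.\<close>

definition has_weak_partial ::
    "(real ^ 'n \<Rightarrow> complex) \<Rightarrow> 'n \<Rightarrow> (real ^ 'n \<Rightarrow> complex) \<Rightarrow> bool"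
  where "has_weak_partial f j g \<longleftrightarrow>
    (\<forall>\<psi>\<in>test_functions.
       (LINT x|lebesgue. g x * \<psi> x) = - (LINT x|lebesgue. f x * partial j \<psi> x))"

text \<open>A representative of the distributional derivative when it lies in \<open>L\<^sup>2\<close>; it is
  determined up to equality almost everywhere.\<close>

definition weak_partial :: "'n \<Rightarrow> (real ^ 'n \<Rightarrow> complex) \<Rightarrow> real ^ 'n \<Rightarrow> complex"
  where "weak_partial j f = (SOME g. g \<in> L2 \<and> has_weak_partial f j g)"

definition wgrad :: "(real ^ 'n \<Rightarrow> complex) \<Rightarrow> real ^ 'n \<Rightarrow> complex ^ 'n"
  where "wgrad f x = (\<chi> j. weak_partial j f x)"

definition xmul :: "(real ^ 'n \<Rightarrow> complex) \<Rightarrow> real ^ 'n \<Rightarrow> complex ^ 'n"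
  where "xmul f x = (\<chi> j. of_real (x $ j) * f x)"

definition M :: "(real ^ 'n \<Rightarrow> complex) set"
  where "M = {\<phi>. \<phi> \<in> L2 \<and>
    (\<forall>j. (\<exists>g. g \<in> L2 \<and> has_weak_partial \<phi> j g) \<and> (\<lambda>x. of_real (x $ j) * \<phi> x) \<in> L2)}"

text \<open>Unlike the library's \<^const>\<open>sgn\<close>, the value at \<open>0\<close> is \<open>1\<close>.\<close>

definition csgn :: "complex \<Rightarrow> complex"
  where "csgn z = (if z = 0 then 1 else z / of_real (norm z))"

end

theory Submission
  imports Defs "HOL-Probability.Distributions" "HOL-Computational_Algebra.Polynomial"
begin

text \<open>Everything reduces to the identity \<open>n \<parallel>\<phi>\<parallel>\<^sup>2 = - 2 Re (x\<phi> | \<nabla>\<phi>)\<close>, after which the formulas of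
  (1) and the equivalences (i) \<open>\<longleftrightarrow>\<close> (ii) are expansions of \<open>\<parallel>\<alpha> x\<phi> + \<beta> \<nabla>\<phi>\<parallel>\<^sup>2\<close>.  The identity comes from
  translations: the difference quotients of \<open>\<phi>\<close> converge weakly in \<open>L\<^sup>2\<close> to the weak derivative, because
  test functions are dense and the quotients are bounded by the norm of the derivative; comparing the
  translate of \<open>x\<^sub>j \<phi>\<close> with \<open>x\<^sub>j\<close> times the translate of \<open>\<phi>\<close> produces the term \<open>\<parallel>\<phi>\<parallel>\<^sup>2\<close>.  All three conditions (ii)
  have the form \<open>\<nabla>\<phi> = w x\<phi>\<close> with \<open>Re w < 0\<close>; then \<open>\<phi> exp (- w \<bar>x\<bar>\<^sup>2 / 2)\<close> has vanishing gradient, so it is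
  invariant under all translations and hence constant, which gives (iii).\<close>

subsection \<open>Square integrable functions\<close>

text \<open>Integrating by parts through test functions close to \<phi> would require approximation
  of \<phi>, x\<phi> and \<nabla>\<phi> at once, hence cutoffs and mollifiers. Translations act
  isometrically on L2, and testing difference quotients against a fixed L2 function needs density in
  the plain L2 norm only. The unbounded weight is harmless, as a translation changes
  \<open>x $ j\<close> by a constant. Two obstacles shape the rest. For Re w < 0 the integrating
  factor exp (- w |x|^2 / 2) grows, so its product with \<phi> is controlled only on bounded sets;
  this is the reason for \<open>L2_loc\<close>. And invariance under a single translation comes with
  a null set depending on that translation; Fubini replaces all of these by one good base point. In
  (4) the sign Re w < 0 is forced by the identity, which makes Re (x\<phi> | \<nabla>\<phi>)
  negative. The exponent n/4 comes from ||gauss w||^2 = (pi / (- Re w))^(n/2).\<close>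

lemma L2_measurable: "f \<in> L2 \<Longrightarrow> f \<in> borel_measurable lebesgue"
  by (simp add: L2_def)

lemma L2_integrable: "f \<in> L2 \<Longrightarrow> integrable lebesgue (\<lambda>x. (norm (f x))\<^sup>2)"
  by (simp add: L2_def)

lemma L2_dominated:
  fixes f :: "'a::euclidean_space \<Rightarrow> 'b::euclidean_space" and g :: "'a \<Rightarrow> 'c::euclidean_space"
  assumes "g \<in> L2" "f \<in> borel_measurable lebesgue"
    and "AE x in lebesgue. norm (f x) \<le> c * norm (g x)"
  shows "f \<in> L2"
proof -
  have i: "integrable lebesgue (\<lambda>x. c\<^sup>2 * (norm (g x))\<^sup>2)"
    using L2_integrable[OF assms(1)] by simp
  have "integrable lebesgue (\<lambda>x. (norm (f x))\<^sup>2)"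
  proof (rule Bochner_Integration.integrable_bound[OF i])
    show "(\<lambda>x. (norm (f x))\<^sup>2) \<in> borel_measurable lebesgue"
      using assms(2) by measurable
    show "AE x in lebesgue. norm ((norm (f x))\<^sup>2) \<le> norm (c\<^sup>2 * (norm (g x))\<^sup>2)"
      using assms(3)
    proof eventually_elim
      case (elim x)
      have "(norm (f x))\<^sup>2 \<le> (c * norm (g x))\<^sup>2"
        using elim by (intro power_mono) auto
      then show ?case by (simp add: power_mult_distrib)
    qed
  qed
  then show ?thesis using assms(2) by (simp add: L2_def)
qed

lemma L2_add:
  fixes f g :: "'a::euclidean_space \<Rightarrow> 'b::euclidean_space"
  assumes "f \<in> L2" "g \<in> L2"
  shows "(\<lambda>x. f x + g x) \<in> L2"
proof -
  have m: "(\<lambda>x. f x + g x) \<in> borel_measurable lebesgue"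
    using assms L2_measurable by (intro borel_measurable_add) auto
  have i: "integrable lebesgue (\<lambda>x. 2 * (norm (f x))\<^sup>2 + 2 * (norm (g x))\<^sup>2)"
    using assms by (auto intro!: L2_integrable)
  have "integrable lebesgue (\<lambda>x. (norm (f x + g x))\<^sup>2)"
  proof (rule Bochner_Integration.integrable_bound[OF i])
    show "(\<lambda>x. (norm (f x + g x))\<^sup>2) \<in> borel_measurable lebesgue"
      using m by measurable
    have "(norm (f x + g x))\<^sup>2 \<le> 2 * (norm (f x))\<^sup>2 + 2 * (norm (g x))\<^sup>2" for x
    proof -
      have "(norm (f x + g x))\<^sup>2 \<le> (norm (f x) + norm (g x))\<^sup>2"
        by (intro power_mono norm_triangle_ineq) auto
      also have "\<dots> \<le> 2 * (norm (f x))\<^sup>2 + 2 * (norm (g x))\<^sup>2"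
        using zero_le_power2[of "norm (f x) - norm (g x)"]
        by (simp add: power2_sum power2_diff)
      finally show ?thesis .
    qed
    then show "AE x in lebesgue. norm ((norm (f x + g x))\<^sup>2)
        \<le> norm (2 * (norm (f x))\<^sup>2 + 2 * (norm (g x))\<^sup>2)"
      by simp
  qed
  then show ?thesis using m by (simp add: L2_def)
qed

lemma L2_scaleR:
  fixes f :: "'a::euclidean_space \<Rightarrow> 'b::euclidean_space"
  assumes "f \<in> L2"
  shows "(\<lambda>x. c *\<^sub>R f x) \<in> L2"
proof (rule L2_dominated[where g=f and c="\<bar>c\<bar>"])
  show "(\<lambda>x. c *\<^sub>R f x) \<in> borel_measurable lebesgue"
    by (intro borel_measurable_scaleR borel_measurable_const L2_measurable assms)
qed (use assms in auto)

lemma L2_minus: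
  fixes f :: "'a::euclidean_space \<Rightarrow> 'b::euclidean_space"
  shows "f \<in> L2 \<Longrightarrow> (\<lambda>x. - f x) \<in> L2"
  using L2_scaleR[of f "-1"] by simp

lemma L2_diff:
  fixes f g :: "'a::euclidean_space \<Rightarrow> 'b::euclidean_space"
  shows "f \<in> L2 \<Longrightarrow> g \<in> L2 \<Longrightarrow> (\<lambda>x. f x - g x) \<in> L2"
  using L2_add[OF _ L2_minus, of f g] by simp

lemma L2_cnj:
  assumes "f \<in> L2"
  shows "(\<lambda>x. cnj (f x)) \<in> L2"
proof (rule L2_dominated[where g=f and c=1])
  have "cnj \<in> borel_measurable borel"
    by (intro borel_measurable_continuous_onI continuous_intros)
  then show "(\<lambda>x. cnj (f x)) \<in> borel_measurable lebesgue"
    by (rule measurable_compose[OF L2_measurable[OF assms]])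
qed (use assms in auto)

lemma L2_mult_bounded:
  fixes f g :: "'a::euclidean_space \<Rightarrow> complex"
  assumes "f \<in> L2" "g \<in> borel_measurable lebesgue" "\<And>x. norm (g x) \<le> c"
  shows "(\<lambda>x. f x * g x) \<in> L2"
proof (rule L2_dominated[where g=f and c=c])
  show "(\<lambda>x. f x * g x) \<in> borel_measurable lebesgue"
    by (intro borel_measurable_times L2_measurable assms)
  show "AE x in lebesgue. norm (f x * g x) \<le> c * norm (f x)"
    by (intro AE_I2) (metis assms(3) mult_left_mono norm_ge_zero norm_mult mult.commute)
qed (rule assms)

lemma L2_cmult:
  fixes f :: "'a::euclidean_space \<Rightarrow> complex"
  assumes "f \<in> L2"
  shows "(\<lambda>x. c * f x) \<in> L2"
proof -
  have "(\<lambda>x. f x * c) \<in> L2"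
    by (rule L2_mult_bounded[OF assms, of _ "norm c"]) auto
  then show ?thesis by (simp only: mult.commute[of c])
qed

lemma L2_AE_cong:
  fixes f g :: "'a::euclidean_space \<Rightarrow> 'b::euclidean_space"
  assumes f: "f \<in> L2" and ae: "f =\<^sub>a\<^sub>e g"
  shows "g \<in> L2"
proof (rule L2_dominated[where g=f and c=1])
  show "g \<in> borel_measurable lebesgue"
    by (rule borel_measurable_AE[OF L2_measurable[OF f] ae])
  show "AE x in lebesgue. norm (g x) \<le> 1 * norm (f x)"
    using ae by eventually_elim simp
qed (rule f)

lemma l2_norm_nonneg: "0 \<le> l2_norm f"
  by (simp add: l2_norm_def)

lemma l2_norm_sq: "(l2_norm f)\<^sup>2 = (LINT x|lebesgue. (norm (f x))\<^sup>2)"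
  by (simp add: l2_norm_def)

lemma l2_norm_AE_cong:
  assumes "f \<in> L2" "g \<in> L2" "f =\<^sub>a\<^sub>e g"
  shows "l2_norm f = l2_norm g"
proof -
  have "(LINT x|lebesgue. (norm (f x))\<^sup>2) = (LINT x|lebesgue. (norm (g x))\<^sup>2)"
  proof (rule integral_cong_AE)
    show "AE x in lebesgue. (norm (f x))\<^sup>2 = (norm (g x))\<^sup>2"
      using assms(3) by eventually_elim simp
  qed (rule borel_measurable_integrable[OF L2_integrable] assms)+
  then show ?thesis by (simp add: l2_norm_def)
qed

lemma l2_norm_eq_0_iff:
  assumes "f \<in> L2"
  shows "l2_norm f = 0 \<longleftrightarrow> f =\<^sub>a\<^sub>e (\<lambda>_. 0)"
  unfolding l2_norm_def
  using integral_nonneg_eq_0_iff_AE[OF L2_integrable[OF assms]] by simp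

lemma L2_prod_norm_integrable:
  assumes "f \<in> L2" "g \<in> L2"
  shows "integrable lebesgue (\<lambda>x. norm (f x) * norm (g x))"
proof (rule Bochner_Integration.integrable_bound)
  show "integrable lebesgue (\<lambda>x. (norm (f x))\<^sup>2 + (norm (g x))\<^sup>2)"
    using assms by (auto intro!: L2_integrable)
  show "(\<lambda>x. norm (f x) * norm (g x)) \<in> borel_measurable lebesgue"
    using assms[THEN L2_measurable] by measurable
  have "a * b \<le> a\<^sup>2 + b\<^sup>2" if "0 \<le> a" "0 \<le> b" for a b :: real
    using sum_squares_bound[of a b] mult_nonneg_nonneg[OF that] by linarith
  then show "AE x in lebesgue. norm (norm (f x) * norm (g x)) \<le> norm ((norm (f x))\<^sup>2 + (norm (g x))\<^sup>2)"
    by simp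
qed

text \<open>Expand the nonnegative integral of (b |f| - a |g|)^2, where a and b are the norms of f
  and g. This gives 2ab times the claim, so the case ab = 0, where one factor vanishes almost
  everywhere, is treated apart.\<close>

lemma L2_Cauchy_Schwarz_norm:
  assumes f: "f \<in> L2" and g: "g \<in> L2"
  shows "(LINT x|lebesgue. norm (f x) * norm (g x)) \<le> l2_norm f * l2_norm g"
proof (cases "l2_norm f = 0 \<or> l2_norm g = 0")
  case True
  then have "AE x in lebesgue. norm (f x) * norm (g x) = 0"
    using l2_norm_eq_0_iff[OF f] l2_norm_eq_0_iff[OF g] by auto
  then have "(LINT x|lebesgue. norm (f x) * norm (g x)) = 0"
    by (rule integral_eq_zero_AE)
  then show ?thesis using True by auto
next
  case False
  define a where "a = l2_norm f"
  define b where "b = l2_norm g"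
  have ab: "0 < a" "0 < b" using False l2_norm_nonneg[of f] l2_norm_nonneg[of g]
    by (auto simp: a_def b_def)
  note i = L2_integrable[OF f] L2_integrable[OF g] L2_prod_norm_integrable[OF f g]
  have "0 \<le> (LINT x|lebesgue. (b * norm (f x) - a * norm (g x))\<^sup>2)"
    by simp
  also have "\<dots> = (LINT x|lebesgue. b\<^sup>2 * (norm (f x))\<^sup>2 + a\<^sup>2 * (norm (g x))\<^sup>2
      - (2 * a * b) * (norm (f x) * norm (g x)))"
    by (intro Bochner_Integration.integral_cong refl) (simp add: power2_eq_square algebra_simps)
  also have "\<dots> = b\<^sup>2 * a\<^sup>2 + a\<^sup>2 * b\<^sup>2 - (2 * a * b) * (LINT x|lebesgue. norm (f x) * norm (g x))"
    using i by (simp add: a_def b_def l2_norm_sq)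
  finally have "(2 * a * b) * (LINT x|lebesgue. norm (f x) * norm (g x)) \<le> (2 * a * b) * (a * b)"
    by (simp add: power2_eq_square algebra_simps)
  then show ?thesis using ab by (simp add: a_def b_def)
qed

lemma L2_mult_integrable:
  fixes f g :: "'a::euclidean_space \<Rightarrow> complex"
  assumes "f \<in> L2" "g \<in> L2"
  shows "integrable lebesgue (\<lambda>x. f x * g x)"
proof (rule Bochner_Integration.integrable_bound[OF L2_prod_norm_integrable[OF assms]])
  show "(\<lambda>x. f x * g x) \<in> borel_measurable lebesgue"
    by (intro borel_measurable_times L2_measurable assms)
qed (simp add: norm_mult)

lemma L2_Cauchy_Schwarz:
  fixes f g :: "'a::euclidean_space \<Rightarrow> complex"
  assumes "f \<in> L2" "g \<in> L2"
  shows "norm (LINT x|lebesgue. f x * g x) \<le> l2_norm f * l2_norm g"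
proof -
  have "norm (LINT x|lebesgue. f x * g x) \<le> (LINT x|lebesgue. norm (f x * g x))"
    by (rule integral_norm_bound)
  also have "\<dots> \<le> l2_norm f * l2_norm g"
    using L2_Cauchy_Schwarz_norm[OF assms] by (simp add: norm_mult)
  finally show ?thesis .
qed

lemma l2_norm_triangle:
  fixes f g :: "'a::euclidean_space \<Rightarrow> 'b::euclidean_space"
  assumes f: "f \<in> L2" and g: "g \<in> L2"
  shows "l2_norm (\<lambda>x. f x + g x) \<le> l2_norm f + l2_norm g"
proof (rule power2_le_imp_le)
  note i = L2_integrable[OF f] L2_integrable[OF g] L2_prod_norm_integrable[OF f g]
  have "(l2_norm (\<lambda>x. f x + g x))\<^sup>2 \<le> (LINT x|lebesgue. (norm (f x))\<^sup>2 + (norm (g x))\<^sup>2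
      + 2 * (norm (f x) * norm (g x)))"
    unfolding l2_norm_sq
  proof (rule integral_mono)
    show "(norm (f x + g x))\<^sup>2 \<le> (norm (f x))\<^sup>2 + (norm (g x))\<^sup>2 + 2 * (norm (f x) * norm (g x))" for x
      using power_mono[OF norm_triangle_ineq[of "f x" "g x"], of 2] by (simp add: power2_sum)
  qed (use i L2_integrable[OF L2_add[OF f g]] in auto)
  also have "\<dots> \<le> (l2_norm f)\<^sup>2 + (l2_norm g)\<^sup>2 + 2 * (l2_norm f * l2_norm g)"
    using i L2_Cauchy_Schwarz_norm[OF f g] by (simp add: l2_norm_sq)
  finally show "(l2_norm (\<lambda>x. f x + g x))\<^sup>2 \<le> (l2_norm f + l2_norm g)\<^sup>2"
    by (simp add: power2_sum)
qed (simp add: l2_norm_nonneg)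

lemma l2_norm_cmult:
  fixes f :: "'a::euclidean_space \<Rightarrow> complex"
  shows "l2_norm (\<lambda>x. c * f x) = norm c * l2_norm f"
  unfolding l2_norm_def by (simp add: norm_mult power_mult_distrib real_sqrt_mult)

lemma L2_vecI:
  fixes f :: "'a::euclidean_space \<Rightarrow> complex ^ 'n"
  assumes "\<And>j. (\<lambda>x. f x $ j) \<in> L2"
  shows "f \<in> L2"
proof -
  \<comment> \<open>Measurability of the vector-valued function: it is a finite sum of continuous
    embeddings \<open>axis j\<close> of its measurable components.\<close>
  have e: "f = (\<lambda>x. \<Sum>j\<in>UNIV. axis j (f x $ j))"
    by (auto simp: fun_eq_iff vec_eq_iff axis_def)
  have c: "continuous_on UNIV (\<lambda>z::complex. axis j z :: complex ^ 'n)" for j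
    unfolding axis_def
  proof (rule continuous_on_vec_lambda)
    show "continuous_on UNIV (\<lambda>z::complex. if i = j then z else 0)" for i
      by (cases "i = j") auto
  qed
  have "(\<lambda>x. \<Sum>j\<in>UNIV. axis j (f x $ j)) \<in> borel_measurable lebesgue"
    by (intro borel_measurable_sum measurable_compose[OF L2_measurable[OF assms]]
        borel_measurable_continuous_onI c)
  then have m: "f \<in> borel_measurable lebesgue" using e by simp
  have "(\<lambda>x. (norm (f x))\<^sup>2) = (\<lambda>x. \<Sum>j\<in>UNIV. (norm (f x $ j))\<^sup>2)"
    by (simp add: norm_vec_def L2_set_def sum_nonneg)
  then show ?thesis using m assms[THEN L2_integrable] by (auto simp: L2_def)
qed

lemma L2_vecD:
  fixes f :: "'a::euclidean_space \<Rightarrow> complex ^ 'n"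
  assumes "f \<in> L2"
  shows "(\<lambda>x. f x $ j) \<in> L2"
proof (rule L2_dominated[where g=f and c=1])
  have "(\<lambda>v::complex ^ 'n. v $ j) \<in> borel_measurable borel"
    by (intro borel_measurable_continuous_onI continuous_on_component continuous_on_id)
  then show "(\<lambda>x. f x $ j) \<in> borel_measurable lebesgue"
    by (rule measurable_compose[OF L2_measurable[OF assms]])
qed (use assms Finite_Cartesian_Product.norm_nth_le in auto)

text \<open>Pointwise |a + b|^2 = |a|^2 + |b|^2 + 2 Re (a conj b), summed over the components and
  integrated. Every norm of a sum or difference in the theorem is expanded through this.\<close>

lemma l2_norm_add_sq:
  fixes f g :: "'a::euclidean_space \<Rightarrow> complex ^ 'n"
  assumes f: "f \<in> L2" and g: "g \<in> L2"
  shows "(l2_norm (\<lambda>x. f x + g x))\<^sup>2 = (l2_norm f)\<^sup>2 + (l2_norm g)\<^sup>2 + 2 * Re (l2_inner f g)"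
proof -
  have n: "(norm v)\<^sup>2 = (\<Sum>j\<in>UNIV. (norm (v $ j))\<^sup>2)" for v :: "complex ^ 'n"
    by (simp add: norm_vec_def L2_set_def sum_nonneg)
  have z: "(cmod (a + b))\<^sup>2 = (cmod a)\<^sup>2 + (cmod b)\<^sup>2 + 2 * Re (a * cnj b)" for a b
    unfolding cmod_power2 by (simp add: power2_eq_square algebra_simps)
  have i: "integrable lebesgue (\<lambda>x. f x $ j * cnj (g x $ j))" for j
    by (intro L2_mult_integrable L2_cnj L2_vecD f g)
  have p: "(norm (f x + g x))\<^sup>2 = (norm (f x))\<^sup>2 + (norm (g x))\<^sup>2
      + 2 * (\<Sum>j\<in>UNIV. Re (f x $ j * cnj (g x $ j)))" for x
    unfolding n by (simp only: vector_add_component z sum.distrib sum_distrib_left)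
  have "Re (l2_inner f g) = (LINT x|lebesgue. (\<Sum>j\<in>UNIV. Re (f x $ j * cnj (g x $ j))))"
    unfolding l2_inner_def Re_sum integral_Re[OF i, symmetric]
    by (rule Bochner_Integration.integral_sum[symmetric]) (rule integrable_Re[OF i])
  moreover have "integrable lebesgue (\<lambda>x. \<Sum>j\<in>UNIV. Re (f x $ j * cnj (g x $ j)))"
    by (intro Bochner_Integration.integrable_sum integrable_Re i)
  ultimately show ?thesis
    unfolding l2_norm_sq p using L2_integrable[OF f] L2_integrable[OF g]
    by (simp del: Re_sum times_complex.sel)
qed

subsection \<open>Smooth functions\<close>

lemma partial_eq: "(f has_derivative D) (at x) \<Longrightarrow> partial j f x = D (axis j 1)"
  unfolding partial_def by (metis frechet_derivative_at)

text \<open>\<open>partial\<close> is defined through \<open>frechet_derivative\<close>; this rule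
  lets the derivative be supplied in closed form.\<close>

lemma C_k_SucI:
  assumes "\<And>x. (f has_derivative D x) (at x)" "\<And>j. C_k k (\<lambda>x. D x (axis j 1))"
  shows "C_k (Suc k) f"
proof -
  have "partial j f = (\<lambda>x. D x (axis j 1))" for j
    using partial_eq[OF assms(1)] by blast
  then show ?thesis using assms by (auto simp: differentiable_def)
qed

lemma C_k_continuous: "C_k k f \<Longrightarrow> continuous_on UNIV f"
  by (cases k) (auto intro!: continuous_at_imp_continuous_on differentiable_imp_continuous_within)

text \<open>The product rule keeps undifferentiated factors, for which the induction on the order of
  smoothness has to drop one order.\<close>

lemma C_k_Suc_imp: "C_k (Suc k) f \<Longrightarrow> C_k k f"
proof (induction k arbitrary: f)
  case 0
  then show ?case using C_k_continuous[of "Suc 0" f] by simp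
next
  case (Suc k)
  have "C_k k (partial j f)" for j
    using Suc.prems by (intro Suc.IH) simp
  then show ?case using Suc.prems by simp
qed

lemma has_derivative_partial:
  "f differentiable (at x) \<Longrightarrow> (f has_derivative frechet_derivative f (at x)) (at x)"
  by (simp add: frechet_derivative_works)

lemma C_k_frechet_derivative:
  assumes "C_k (Suc k) f"
  shows "C_k k (\<lambda>x. frechet_derivative f (at x) (axis j 1))"
proof -
  have "partial j f = (\<lambda>x. frechet_derivative f (at x) (axis j 1))"
    by (simp add: partial_def fun_eq_iff)
  then show ?thesis using assms by (metis C_k.simps(2))
qed

lemma C_k_const: "C_k k (\<lambda>x. c)"
proof (induction k arbitrary: c)
  case (Suc k)
  show ?case by (rule C_k_SucI[where D="\<lambda>_ _. 0"]) (auto intro: Suc)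
qed simp

lemma C_k_add: "C_k k f \<Longrightarrow> C_k k g \<Longrightarrow> C_k k (\<lambda>x. f x + g x)"
proof (induction k arbitrary: f g)
  case 0
  then show ?case by (auto intro: continuous_intros)
next
  case (Suc k)
  show ?case
  proof (rule C_k_SucI)
    show "((\<lambda>x. f x + g x) has_derivative
        (\<lambda>h. frechet_derivative f (at x) h + frechet_derivative g (at x) h)) (at x)" for x
      using Suc.prems by (intro has_derivative_add has_derivative_partial) auto
    show "C_k k (\<lambda>x. frechet_derivative f (at x) (axis j 1) + frechet_derivative g (at x) (axis j 1))" for j
      by (rule Suc.IH[OF Suc.prems[THEN C_k_frechet_derivative]])
  qed
qed

lemma C_k_mult:
  fixes f g :: "real ^ 'n \<Rightarrow> complex"
  shows "C_k k f \<Longrightarrow> C_k k g \<Longrightarrow> C_k k (\<lambda>x. f x * g x)"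
proof (induction k arbitrary: f g)
  case 0
  then show ?case by (auto intro: continuous_intros)
next
  case (Suc k)
  show ?case
  proof (rule C_k_SucI)
    show "((\<lambda>x. f x * g x) has_derivative
        (\<lambda>h. f x * frechet_derivative g (at x) h + frechet_derivative f (at x) h * g x)) (at x)" for x
      using Suc.prems by (intro has_derivative_mult has_derivative_partial) simp_all
    show "C_k k (\<lambda>x. f x * frechet_derivative g (at x) (axis j 1) + frechet_derivative f (at x) (axis j 1) * g x)" for j
      by (rule C_k_add[OF
            Suc.IH[OF C_k_Suc_imp[OF Suc.prems(1)] C_k_frechet_derivative[OF Suc.prems(2)]]
            Suc.IH[OF C_k_frechet_derivative[OF Suc.prems(1)] C_k_Suc_imp[OF Suc.prems(2)]]])
  qed
qed

lemma C_k_prod: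
  fixes f :: "'i \<Rightarrow> real ^ 'n \<Rightarrow> complex"
  assumes "finite I" "\<And>i. i \<in> I \<Longrightarrow> C_k k (f i)"
  shows "C_k k (\<lambda>x. \<Prod>i\<in>I. f i x)"
  using assms
proof (induction I)
  case empty
  then show ?case by (simp add: C_k_const)
next
  case (insert i I)
  have "C_k k (\<lambda>x. f i x * (\<Prod>i\<in>I. f i x))"
    using insert by (intro C_k_mult) simp_all
  then show ?case using insert by simp
qed

lemma has_derivative_translate:
  assumes "(f has_derivative D) (at (x + a))"
  shows "((\<lambda>x. f (x + a)) has_derivative D) (at x)"
proof -
  have "((\<lambda>x. x + a) has_derivative (\<lambda>h. h)) (at x)"
    by (auto intro!: derivative_eq_intros)
  from has_derivative_compose[OF this assms] show ?thesis .
qed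

lemma partial_translate:
  assumes "f differentiable (at (x + a))"
  shows "partial j (\<lambda>x. f (x + a)) x = partial j f (x + a)"
  using partial_eq[OF has_derivative_translate[OF has_derivative_partial[OF assms]]]
  by (simp add: partial_def)

lemma C_k_translate: "C_k k f \<Longrightarrow> C_k k (\<lambda>x. f (x + a))"
proof (induction k arbitrary: f)
  case 0
  then show ?case
    by (auto intro!: continuous_on_compose2[of UNIV f] continuous_intros)
next
  case (Suc k)
  show ?case
  proof (rule C_k_SucI)
    show "((\<lambda>x. f (x + a)) has_derivative frechet_derivative f (at (x + a))) (at x)" for x
      using Suc.prems by (intro has_derivative_translate has_derivative_partial) auto
    show "C_k k (\<lambda>x. frechet_derivative f (at (x + a)) (axis j 1))" for j
      by (rule Suc.IH[OF C_k_frechet_derivative[OF Suc.prems]])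
  qed
qed

lemma C_k_coord: "C_k k (\<lambda>x::real ^ 'n. complex_of_real (x $ i))"
proof (cases k)
  case 0
  then show ?thesis by (auto intro!: continuous_intros)
next
  case (Suc m)
  have "C_k (Suc m) (\<lambda>x::real ^ 'n. complex_of_real (x $ i))"
  proof (rule C_k_SucI)
    show "((\<lambda>x. complex_of_real (x $ i)) has_derivative (\<lambda>h. complex_of_real (h $ i))) (at x)" for x :: "real ^ 'n"
      by (intro bounded_linear_imp_has_derivative bounded_linear_compose[OF bounded_linear_of_real bounded_linear_vec_nth])
  qed (rule C_k_const)
  then show ?thesis by (simp add: Suc)
qed

text \<open>The half makes the gradient exactly w x times the function, so this is the model
  solution of \<nabla>\<phi> = w x\<phi>. Complex w is needed for (4), and \<open>- w\<close> gives
  the reciprocal.\<close>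

definition gauss :: "complex \<Rightarrow> real ^ 'n \<Rightarrow> complex"
  where "gauss w x = exp (w * of_real ((norm x)\<^sup>2 / 2))"

lemma gauss_has_derivative:
  "(gauss w has_derivative (\<lambda>h. gauss w x * (w * of_real (x \<bullet> h)))) (at x)"
proof -
  have "((\<lambda>x. w * of_real (x \<bullet> x / 2)) has_derivative (\<lambda>h. w * of_real (x \<bullet> h))) (at x)"
    by (auto intro!: derivative_eq_intros simp: inner_commute)
  then have "((\<lambda>x. exp (w * of_real (x \<bullet> x / 2))) has_derivative
      (\<lambda>h. exp (w * of_real (x \<bullet> x / 2)) * (w * of_real (x \<bullet> h)))) (at x)"
    using has_derivative_compose[OF _ DERIV_exp[unfolded has_field_derivative_def]] by blast
  then show ?thesis
    by (simp add: gauss_def[abs_def] power2_norm_eq_inner)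
qed

lemma partial_gauss: "partial j (gauss w) x = w * (of_real (x $ j) * gauss w x)"
  using partial_eq[OF gauss_has_derivative] by (simp add: inner_axis mult_ac)

text \<open>The derivative is the Gaussian itself times a linear polynomial, so the induction closes
  through \<open>C_k_mult\<close>.\<close>

lemma C_k_gauss: "C_k k (gauss w :: real ^ 'n \<Rightarrow> complex)"
proof (induction k)
  case 0
  show ?case unfolding gauss_def[abs_def] by (auto intro!: continuous_intros)
next
  case (Suc k)
  show ?case
  proof (rule C_k_SucI[OF gauss_has_derivative])
    show "C_k k (\<lambda>x. gauss w x * (w * complex_of_real (x \<bullet> axis j 1)))" for j :: 'n
      using C_k_mult[OF Suc C_k_mult[OF C_k_const[of k w] C_k_coord[of k j]]] by (simp add: inner_axis)
  qed
qed

subsection \<open>Smooth bump functions\<close>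

text \<open>Multiplying \<open>exp (-1/t)\<close> by polynomials in \<open>1/t\<close> gives a class of functions that is closed
  under differentiation.\<close>

definition flat :: "real poly \<Rightarrow> real \<Rightarrow> real"
  where "flat p t = (if t > 0 then poly p (1 / t) * exp (- (1 / t)) else 0)"

lemma poly_over_exp_tendsto_0: "((\<lambda>u. poly p u / exp u) \<longlongrightarrow> (0::real)) at_top"
proof -
  have "((\<lambda>u. \<Sum>i\<le>degree p. coeff p i * (u ^ i / exp u)) \<longlongrightarrow> (\<Sum>i\<le>degree p. coeff p i * 0)) at_top"
    by (intro tendsto_intros tendsto_power_div_exp_0)
  then show ?thesis by (simp add: poly_altdef sum_divide_distrib)
qed

text \<open>With u = 1/t, the derivative of p(u) exp (-u) in t is u^2 (p - p')(u) exp (-u), which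
  explains \<open>[:0, 0, 1:]\<close>. For t < 0 the function is locally zero, and at 0 exponential
  decay beats every polynomial.\<close>

lemma flat_has_derivative:
  "(flat p has_field_derivative flat ([:0, 0, 1:] * (p - pderiv p)) t) (at t)"
proof -
  consider "t > 0" | "t < 0" | "t = 0" by linarith
  then show ?thesis
  proof cases
    case 1
    have "((\<lambda>t. poly p (1 / t) * exp (- (1 / t))) has_field_derivative
        flat ([:0, 0, 1:] * (p - pderiv p)) t) (at t)"
      using 1
      by (auto intro!: derivative_eq_intros DERIV_chain2[OF poly_DERIV]
          simp: flat_def field_simps power2_eq_square)
    moreover have "eventually (\<lambda>s. flat p s = poly p (1 / s) * exp (- (1 / s))) (nhds t)"
      using eventually_nhds_in_open[of "{0<..}" t] 1 by (auto simp: flat_def elim: eventually_mono)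
    ultimately show ?thesis by (subst DERIV_cong_ev) auto
  next
    case 2
    have "eventually (\<lambda>s. flat p s = 0) (nhds t)"
      using eventually_nhds_in_open[of "{..<0}" t] 2 by (auto simp: flat_def elim: eventually_mono)
    then have "(flat p has_field_derivative 0) (at t)"
      by (subst DERIV_cong_ev[where g="\<lambda>_. 0"]) auto
    then show ?thesis using 2 by (simp add: flat_def)
  next
    case 3
    have "filterlim (\<lambda>h::real. 1 / h) at_top (at_right 0)"
      using filterlim_inverse_at_top_right by (simp add: inverse_eq_divide)
    \<comment> \<open>Dividing \<open>flat p h\<close> by h multiplies the polynomial by u = 1/h,
      whence \<open>[:0, 1:] * p\<close>.\<close>
    from filterlim_compose[OF poly_over_exp_tendsto_0[of "[:0, 1:] * p"] this]
    have "((\<lambda>h. flat p h / h) \<longlongrightarrow> 0) (at_right 0)"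
      by (rule Lim_transform_eventually)
         (auto simp: eventually_at_right_less flat_def exp_minus field_simps
           intro!: eventually_mono[OF eventually_at_right_less])
    moreover have "((\<lambda>h. flat p h / h) \<longlongrightarrow> 0) (at_left 0)"
      by (rule tendsto_eventually)
         (auto simp: flat_def eventually_at_filter)
    ultimately have "((\<lambda>h. flat p h / h) \<longlongrightarrow> 0) (at 0)"
      by (rule filterlim_split_at_real[rotated])
    then show ?thesis using 3 by (simp add: DERIV_def flat_def)
  qed
qed

text \<open>The polynomial changes with each derivative, so the induction runs over all p. The slope
  c may be negative, as the bumps use both \<open>x $ i - a $ i\<close> and
  \<open>b $ i - x $ i\<close>.\<close>

lemma C_k_flat:
  "C_k k (\<lambda>x::real ^ 'n. complex_of_real (flat p (c * x $ i + d)))"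
proof (induction k arbitrary: p)
  case 0
  have "isCont (flat p) t" for t
    using flat_has_derivative by (rule DERIV_isCont)
  then have "continuous_on UNIV (flat p)"
    by (simp add: continuous_at_imp_continuous_on)
  then show ?case
    by (auto intro!: continuous_intros continuous_on_compose2[of UNIV "flat p"])
next
  case (Suc k)
  let ?q = "[:0, 0, 1:] * (p - pderiv p)"
  show ?case
  proof (rule C_k_SucI)
    fix x :: "real ^ 'n"
    have "((\<lambda>x. c * x $ i + d) has_derivative (\<lambda>h. c * h $ i)) (at x)"
      by (auto intro!: derivative_eq_intros bounded_linear_imp_has_derivative bounded_linear_vec_nth)
    from has_derivative_of_real[OF has_derivative_compose[OF this
        flat_has_derivative[unfolded has_field_derivative_def]]]
    show "((\<lambda>x. complex_of_real (flat p (c * x $ i + d))) has_derivative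
        (\<lambda>h. of_real (flat ?q (c * x $ i + d) * (c * h $ i)))) (at x)" .
  next
    show "C_k k (\<lambda>x::real ^ 'n. complex_of_real (flat ?q (c * x $ i + d) * (c * axis j 1 $ i)))" for j :: 'n
      using C_k_mult[OF Suc[of ?q] C_k_const[of k "of_real (c * axis j 1 $ i)"]]
      by (simp only: of_real_mult)
  qed
qed

text \<open>A smooth substitute for the indicator of \<open>box a b\<close>. For every k > 0 it is
  nonzero exactly on the open box, while larger k makes it steeper at the faces.\<close>

definition bump :: "real \<Rightarrow> real ^ 'n \<Rightarrow> real ^ 'n \<Rightarrow> real ^ 'n \<Rightarrow> real"
  where "bump k a b x = (\<Prod>i\<in>UNIV. flat 1 (k * (x $ i - a $ i)) * flat 1 (k * (b $ i - x $ i)))"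

lemma flat_1_bounds: "0 \<le> flat 1 t" "flat 1 t \<le> 1" "0 < flat 1 t \<longleftrightarrow> 0 < t"
  by (auto simp: flat_def)

lemma bump_bounds: "0 \<le> bump k a b x" "bump k a b x \<le> 1"
  unfolding bump_def
  by (auto intro!: prod_nonneg prod_le_1 mult_nonneg_nonneg mult_le_one flat_1_bounds)

lemma bump_pos_iff: "0 < k \<Longrightarrow> bump k a b x \<noteq> 0 \<longleftrightarrow> x \<in> box a b"
proof -
  assume k: "0 < k"
  have e: "flat 1 t \<noteq> 0 \<longleftrightarrow> 0 < t" for t
    by (auto simp: flat_def)
  show ?thesis using k
    by (auto simp: bump_def mem_box_cart e zero_less_mult_iff)
qed

lemma bump_test:
  fixes a b :: "real ^ 'n"
  assumes "0 < k"
  shows "(\<lambda>x. complex_of_real (bump k a b x)) \<in> test_functions"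
proof -
  have e: "(\<lambda>x. complex_of_real (bump k a b x)) = (\<lambda>x. \<Prod>i\<in>UNIV.
      of_real (flat 1 (k * x $ i + (- k * a $ i))) * of_real (flat 1 ((- k) * x $ i + k * b $ i)))"
    by (simp add: bump_def algebra_simps)
  have "{x. complex_of_real (bump k a b x) \<noteq> 0} = box a b"
    using bump_pos_iff[OF assms, of a b] by simp
  then have "compact (closure {x. complex_of_real (bump k a b x) \<noteq> 0})"
    by (simp only: compact_closure bounded_box)
  moreover have "C_k m (\<lambda>x. complex_of_real (bump k a b x))" for m
    unfolding e by (rule C_k_prod[OF finite]) (rule C_k_mult[OF C_k_flat C_k_flat])
  ultimately show ?thesis unfolding test_functions_def by blast
qed

text \<open>Inside the box each factor has the form exp (-1/(k t)) with t > 0 and tends to 1.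
  \<open>Suc k\<close> keeps the scale positive; at scale 0 the bump is identically zero.\<close>

lemma bump_tendsto: "(\<lambda>k. bump (real (Suc k)) a b x) \<longlonglongrightarrow> indicator (box a b) x"
proof (cases "x \<in> box a b")
  case True
  have *: "(\<lambda>k. flat 1 (real (Suc k) * t)) \<longlonglongrightarrow> 1" if "0 < t" for t
  proof -
    have "(\<lambda>k. exp (- (inverse (real (Suc k)) * inverse t))) \<longlonglongrightarrow> exp (- (0 * inverse t))"
      by (intro tendsto_intros LIMSEQ_inverse_real_of_nat)
    then show ?thesis using that by (simp add: flat_def inverse_eq_divide mult_ac)
  qed
  have "(\<lambda>k. bump (real (Suc k)) a b x) \<longlonglongrightarrow> (\<Prod>i\<in>(UNIV::'a set). 1 * 1)"
    unfolding bump_def using True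
    by (intro tendsto_prod tendsto_mult *) (auto simp: mem_box_cart)
  then show ?thesis using True by simp
next
  case False
  then have "bump (real (Suc k)) a b x = 0" for k
    using bump_pos_iff[of "real (Suc k)" a b x] by simp
  then show ?thesis using False by simp
qed

subsection \<open>Translations\<close>

lemma lebesgue_translate:
  "distr lebesgue lebesgue (\<lambda>x. x + a) = (lebesgue :: 'a::euclidean_space measure)"
  "(\<lambda>x. x + a) \<in> lebesgue \<rightarrow>\<^sub>M (lebesgue :: 'a::euclidean_space measure)"
proof -
  \<comment> \<open>A translation is the diagonal affine map all of whose factors are 1, so its
    Jacobian is 1.\<close>
  have e: "(\<lambda>x. a + (\<Sum>j\<in>Basis. (1 * (x \<bullet> j)) *\<^sub>R j)) = (\<lambda>x. x + a)"
    by (simp add: euclidean_representation add.commute)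
  show "(\<lambda>x. x + a) \<in> lebesgue \<rightarrow>\<^sub>M (lebesgue :: 'a::euclidean_space measure)"
    using lebesgue_affine_measurable[of "\<lambda>_::'a. 1" a] unfolding e by simp
  show "distr lebesgue lebesgue (\<lambda>x. x + a) = (lebesgue :: 'a::euclidean_space measure)"
    using lebesgue_affine_euclidean[of "\<lambda>_::'a. 1" a] unfolding e by (simp add: density_1)
qed

lemma borel_measurable_translate:
  assumes "f \<in> borel_measurable lebesgue"
  shows "(\<lambda>x. f (x + a)) \<in> borel_measurable lebesgue"
  by (rule measurable_compose[OF lebesgue_translate(2) assms])

lemma integral_translate:
  fixes f :: "'a::euclidean_space \<Rightarrow> 'b::{banach, second_countable_topology}"
  assumes "f \<in> borel_measurable lebesgue"
  shows "(LINT x|lebesgue. f (x + a)) = (LINT x|lebesgue. f x)"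
  using integral_distr[OF lebesgue_translate(2) assms, of a] by (simp add: lebesgue_translate(1))

lemma integrable_translate:
  fixes f :: "'a::euclidean_space \<Rightarrow> 'b::{banach, second_countable_topology}"
  assumes "integrable lebesgue f"
  shows "integrable lebesgue (\<lambda>x. f (x + a))"
  using integrable_distr[OF lebesgue_translate(2), of a f] assms by (simp add: lebesgue_translate(1))

lemma AE_translate:
  assumes "AE x in lebesgue. P x"
  shows "AE x in lebesgue. P (x + a)"
  by (rule AE_distrD[OF lebesgue_translate(2)]) (simp only: lebesgue_translate(1) assms)

lemma L2_translate:
  assumes "f \<in> L2"
  shows "(\<lambda>x. f (x + a)) \<in> L2"
  using borel_measurable_translate[OF L2_measurable[OF assms]]
    integrable_translate[OF L2_integrable[OF assms]] by (simp add: L2_def)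

lemma l2_norm_translate:
  assumes "f \<in> L2"
  shows "l2_norm (\<lambda>x. f (x + a)) = l2_norm f"
  unfolding l2_norm_def
  using integral_translate[OF borel_measurable_integrable[OF L2_integrable[OF assms]]] by simp

subsection \<open>Test functions\<close>

lemma borel_measurable_lebesgue_continuous:
  "continuous_on UNIV f \<Longrightarrow> f \<in> borel_measurable lebesgue"
  using borel_measurable_continuous_onI[of f] by (simp add: measurable_completion)

lemma test_C_k: "\<psi> \<in> test_functions \<Longrightarrow> C_k k \<psi>"
  by (simp add: test_functions_def)

lemma test_continuous: "\<psi> \<in> test_functions \<Longrightarrow> continuous_on UNIV \<psi>"
  by (rule C_k_continuous[OF test_C_k])

lemma test_measurable: "\<psi> \<in> test_functions \<Longrightarrow> \<psi> \<in> borel_measurable lebesgue"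
  by (rule borel_measurable_lebesgue_continuous[OF test_continuous])

lemma test_differentiable: "\<psi> \<in> test_functions \<Longrightarrow> \<psi> differentiable (at x)"
  using test_C_k[of \<psi> "Suc 0"] by simp

lemma test_functionsI:
  assumes "\<And>k. C_k k \<psi>" "compact K" "\<And>x. x \<notin> K \<Longrightarrow> \<psi> x = 0"
  shows "\<psi> \<in> test_functions"
proof -
  have "closure {x. \<psi> x \<noteq> 0} \<subseteq> K"
    using assms(3) by (intro closure_minimal compact_imp_closed[OF assms(2)]) auto
  then have "compact (closure {x. \<psi> x \<noteq> 0})"
    using closed_Int_compact[OF closed_closure assms(2)] by (metis inf.absorb1)
  then show ?thesis using assms(1) by (simp add: test_functions_def)
qed

lemma test_support:
  assumes "\<psi> \<in> test_functions"
  obtains K where "compact K" "\<And>x. x \<notin> K \<Longrightarrow> \<psi> x = 0"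
proof
  show "compact (closure {x. \<psi> x \<noteq> 0})"
    using assms unfolding test_functions_def by blast
  show "\<psi> x = 0" if "x \<notin> closure {x. \<psi> x \<noteq> 0}" for x
    using that closure_subset[of "{x. \<psi> x \<noteq> 0}"] by blast
qed

lemma test_zero: "(\<lambda>_. 0) \<in> test_functions"
  by (rule test_functionsI[where K="{}"]) (auto intro: C_k_const)

lemma test_add:
  assumes "\<psi> \<in> test_functions" "\<eta> \<in> test_functions"
  shows "(\<lambda>x. \<psi> x + \<eta> x) \<in> test_functions"
proof -
  obtain K where K: "compact K" "\<And>x. x \<notin> K \<Longrightarrow> \<psi> x = 0" by (rule test_support[OF assms(1)]) blast
  obtain L where L: "compact L" "\<And>x. x \<notin> L \<Longrightarrow> \<eta> x = 0" by (rule test_support[OF assms(2)]) blast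
  show ?thesis
  proof (rule test_functionsI[where K="K \<union> L"])
    show "C_k k (\<lambda>x. \<psi> x + \<eta> x)" for k
      by (intro C_k_add test_C_k assms)
  qed (use K L in auto)
qed

lemma test_mult:
  assumes "\<psi> \<in> test_functions" "\<And>k. C_k k f"
  shows "(\<lambda>x. f x * \<psi> x) \<in> test_functions"
proof -
  obtain K where K: "compact K" "\<And>x. x \<notin> K \<Longrightarrow> \<psi> x = 0" by (rule test_support[OF assms(1)]) blast
  show ?thesis
    by (rule test_functionsI[where K=K]) (use K in \<open>auto intro: C_k_mult[OF assms(2) test_C_k[OF assms(1)]]\<close>)
qed

lemma test_translate:
  assumes "\<psi> \<in> test_functions"
  shows "(\<lambda>x. \<psi> (x + a)) \<in> test_functions"
proof -
  obtain K where K: "compact K" "\<And>x. x \<notin> K \<Longrightarrow> \<psi> x = 0" by (rule test_support[OF assms(1)]) blast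
  show ?thesis
  proof (rule test_functionsI[where K="(\<lambda>x. x - a) ` K"])
    show "C_k k (\<lambda>x. \<psi> (x + a))" for k
      by (rule C_k_translate[OF test_C_k[OF assms]])
    show "compact ((\<lambda>x. x - a) ` K)"
      by (intro compact_continuous_image continuous_intros K)
    show "\<psi> (x + a) = 0" if "x \<notin> (\<lambda>x. x - a) ` K" for x
      using that by (intro K(2)) force
  qed
qed

lemma test_partial:
  assumes "\<psi> \<in> test_functions"
  shows "partial j \<psi> \<in> test_functions"
proof -
  obtain K where K: "compact K" "\<And>x. x \<notin> K \<Longrightarrow> \<psi> x = 0" by (rule test_support[OF assms(1)]) blast
  show ?thesis
  proof (rule test_functionsI[OF _ K(1)])
    show "C_k k (partial j \<psi>)" for k
      using test_C_k[OF assms, of "Suc k"] by simp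
    fix x assume x: "x \<notin> K"
    have "(\<psi> has_derivative (\<lambda>_. 0)) (at x)"
    proof (rule has_derivative_transform_within_open)
      show "((\<lambda>_. 0) has_derivative (\<lambda>_. 0)) (at x)" by simp
      show "open (- K)" using K(1) by (simp add: compact_imp_closed open_Compl)
    qed (use x K in auto)
    from partial_eq[OF this] show "partial j \<psi> x = 0" .
  qed
qed

text \<open>One estimate carries boundedness and compact support together; it supplies the majorants
  used later.\<close>

lemma test_bounded:
  assumes "\<psi> \<in> test_functions"
  obtains c r where "0 \<le> c" "0 < r" "\<And>x. norm (\<psi> x) \<le> c * indicator (cball 0 r) x"
proof -
  obtain K where K: "compact K" "\<And>x. x \<notin> K \<Longrightarrow> \<psi> x = 0" by (rule test_support[OF assms(1)]) blast
  obtain r where r: "0 < r" "\<And>x. x \<in> K \<Longrightarrow> norm x \<le> r"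
    using compact_imp_bounded[OF K(1)] bounded_pos by blast
  have "compact (\<psi> ` K)"
    using test_continuous[OF assms] K(1) by (intro compact_continuous_image) (auto intro: continuous_on_subset)
  then obtain c where c: "0 < c" "\<And>x. x \<in> K \<Longrightarrow> norm (\<psi> x) \<le> c"
    using compact_imp_bounded bounded_pos by (metis imageI)
  have "norm (\<psi> x) \<le> c * indicator (cball 0 r) x" for x
    using c r K(2)[of x] by (cases "x \<in> K") (auto simp: indicator_def)
  with c r show ?thesis using that[of c r] by auto
qed

lemma L2_indicator:
  assumes "bounded B" "B \<in> sets lebesgue"
  shows "(\<lambda>x. indicator B x :: real) \<in> L2"
proof -
  have "(\<lambda>x. (norm (indicator B x :: real))\<^sup>2) = indicator B"
    by (auto simp: fun_eq_iff indicator_def)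
  moreover have "emeasure lebesgue B < \<infinity>"
    using bounded_set_imp_lmeasurable[OF assms] by (auto simp: fmeasurable_def)
  ultimately show ?thesis
    using assms by (simp add: L2_def)
qed

lemma test_L2:
  assumes "\<psi> \<in> test_functions"
  shows "\<psi> \<in> L2"
proof -
  obtain c r where cr: "0 \<le> c" "0 < r" "\<And>x. norm (\<psi> x) \<le> c * indicator (cball 0 r) x"
    by (rule test_bounded[OF assms]) blast
  show ?thesis
  proof (rule L2_dominated[OF L2_indicator test_measurable[OF assms]])
    show "AE x in lebesgue. norm (\<psi> x) \<le> c * norm (indicator (cball 0 r) x :: real)"
      using cr by simp
  qed auto
qed

subsection \<open>Density of the test functions\<close>

text \<open>The closure of the test functions in L2. Membership in L2 is included because the
  triangle inequality for \<open>l2_norm\<close> asks for it.\<close>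

definition test_approx :: "(real ^ 'n \<Rightarrow> complex) \<Rightarrow> bool"
  where "test_approx h \<longleftrightarrow> h \<in> L2 \<and> (\<forall>e>0. \<exists>\<psi>\<in>test_functions. l2_norm (\<lambda>x. h x - \<psi> x) < e)"

lemma test_approx_L2: "test_approx h \<Longrightarrow> h \<in> L2"
  by (simp add: test_approx_def)

lemma test_approxE:
  assumes "test_approx h" "0 < e"
  obtains \<psi> where "\<psi> \<in> test_functions" "l2_norm (\<lambda>x. h x - \<psi> x) < e"
  using assms by (auto simp: test_approx_def)

lemma test_approx_test: "\<psi> \<in> test_functions \<Longrightarrow> test_approx \<psi>"
  by (auto simp: test_approx_def test_L2 l2_norm_def intro!: bexI[of _ \<psi>])

lemma test_approx_add:
  assumes f: "test_approx f" and g: "test_approx g"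
  shows "test_approx (\<lambda>x. f x + g x)"
  unfolding test_approx_def
proof (intro conjI allI impI)
  show "(\<lambda>x. f x + g x) \<in> L2"
    by (intro L2_add test_approx_L2 f g)
  fix e :: real assume "0 < e"
  then have e: "0 < e / 2" by simp
  obtain \<psi> where p: "\<psi> \<in> test_functions" "l2_norm (\<lambda>x. f x - \<psi> x) < e / 2" by (rule test_approxE[OF f e])
  obtain \<eta> where c: "\<eta> \<in> test_functions" "l2_norm (\<lambda>x. g x - \<eta> x) < e / 2" by (rule test_approxE[OF g e])
  have "l2_norm (\<lambda>x. (f x - \<psi> x) + (g x - \<eta> x)) \<le> l2_norm (\<lambda>x. f x - \<psi> x) + l2_norm (\<lambda>x. g x - \<eta> x)"
    by (intro l2_norm_triangle L2_diff test_approx_L2 f g test_L2 p c)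
  then have "l2_norm (\<lambda>x. f x + g x - (\<psi> x + \<eta> x)) < e"
    using p c by (simp add: algebra_simps)
  then show "\<exists>\<psi>\<in>test_functions. l2_norm (\<lambda>x. f x + g x - \<psi> x) < e"
    using test_add[OF p(1) c(1)] by (rule rev_bexI[rotated])
qed

lemma test_approx_cmult:
  assumes f: "test_approx f"
  shows "test_approx (\<lambda>x. c * f x)"
  unfolding test_approx_def
proof (intro conjI allI impI)
  show "(\<lambda>x. c * f x) \<in> L2"
    by (intro L2_cmult test_approx_L2 f)
  fix e :: real assume "0 < e"
  \<comment> \<open>\<open>norm c + 1\<close> in place of \<open>norm c\<close> keeps the
    denominator positive when c = 0.\<close>
  then have e: "0 < e / (norm c + 1)" by (auto intro!: divide_pos_pos add_nonneg_pos)
  obtain \<psi> where p: "\<psi> \<in> test_functions" "l2_norm (\<lambda>x. f x - \<psi> x) < e / (norm c + 1)"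
    by (rule test_approxE[OF f e])
  have "l2_norm (\<lambda>x. c * f x - c * \<psi> x) = norm c * l2_norm (\<lambda>x. f x - \<psi> x)"
    using l2_norm_cmult[of c "\<lambda>x. f x - \<psi> x"] by (simp add: algebra_simps)
  also have "\<dots> \<le> (norm c + 1) * l2_norm (\<lambda>x. f x - \<psi> x)"
    by (intro mult_right_mono l2_norm_nonneg) simp
  also have "\<dots> < e"
    using p(2) by (simp add: pos_less_divide_eq add_nonneg_pos mult.commute)
  finally show "\<exists>\<psi>\<in>test_functions. l2_norm (\<lambda>x. c * f x - \<psi> x) < e"
    using test_mult[OF p(1) C_k_const] by (rule rev_bexI[rotated])
qed

lemma test_approx_sum:
  assumes "finite I" "\<And>i. i \<in> I \<Longrightarrow> test_approx (f i)"
  shows "test_approx (\<lambda>x. \<Sum>i\<in>I. f i x)"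
  using assms
proof (induction I)
  case empty
  then show ?case by (simp add: test_approx_test[OF test_zero])
next
  case (insert i I)
  then show ?case using test_approx_add[of "f i" "\<lambda>x. \<Sum>i\<in>I. f i x"] by simp
qed

text \<open>Dominated convergence upgrades pointwise convergence to convergence in L2: the limit
  inherits the bound g, so |h - H i|^2 is at most 4 g^2.\<close>

lemma test_approx_limit:
  fixes g :: "real ^ 'n \<Rightarrow> real"
  assumes H: "\<And>i. test_approx (H i)" and h: "h \<in> borel_measurable lebesgue"
    and g: "g \<in> L2" and le: "\<And>i x. norm (H i x) \<le> g x" and lim: "\<And>x. (\<lambda>i. H i x) \<longlonglongrightarrow> h x"
  shows "test_approx h"
proof -
  have le': "norm (h x) \<le> g x" for x
    by (rule LIMSEQ_le_const2[OF tendsto_norm[OF lim]]) (use le in auto)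
  have hL: "h \<in> L2"
  proof (rule L2_dominated[OF g h])
    show "AE x in lebesgue. norm (h x) \<le> 1 * norm (g x)"
      using le' by (auto intro!: AE_I2 order_trans[OF le'])
  qed
  have "(\<lambda>i. LINT x|lebesgue. (norm (h x - H i x))\<^sup>2) \<longlonglongrightarrow> (LINT x|(lebesgue :: (real ^ 'n) measure). (0::real))"
  proof (rule Bochner_Integration.integral_dominated_convergence[where w="\<lambda>x. 4 * (norm (g x))\<^sup>2"])
    show "(\<lambda>x. (norm (h x - H i x))\<^sup>2) \<in> borel_measurable lebesgue" for i
      by (intro borel_measurable_integrable L2_integrable L2_diff hL test_approx_L2 H)
    show "integrable lebesgue (\<lambda>x. 4 * (norm (g x))\<^sup>2)"
      using L2_integrable[OF g] by simp
    show "AE x in lebesgue. (\<lambda>i. (norm (h x - H i x))\<^sup>2) \<longlonglongrightarrow> 0"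
    proof (rule AE_I2)
      fix x
      have "(\<lambda>i. (norm (h x - H i x))\<^sup>2) \<longlonglongrightarrow> (norm (h x - h x))\<^sup>2"
        by (intro tendsto_intros lim)
      then show "(\<lambda>i. (norm (h x - H i x))\<^sup>2) \<longlonglongrightarrow> 0" by simp
    qed
    show "AE x in lebesgue. norm ((norm (h x - H i x))\<^sup>2) \<le> 4 * (norm (g x))\<^sup>2" for i
    proof (rule AE_I2)
      fix x
      have "norm (h x - H i x) \<le> 2 * g x"
        using norm_triangle_ineq4[of "h x" "H i x"] le[of i x] le'[of x] by linarith
      then have "(norm (h x - H i x))\<^sup>2 \<le> (2 * g x)\<^sup>2"
        by (intro power_mono) auto
      then show "norm ((norm (h x - H i x))\<^sup>2) \<le> 4 * (norm (g x))\<^sup>2"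
        by (simp add: power_mult_distrib)
    qed
  qed simp
  then have "(\<lambda>i. l2_norm (\<lambda>x. h x - H i x)) \<longlonglongrightarrow> 0"
    unfolding l2_norm_def using tendsto_real_sqrt by fastforce
  show ?thesis
    unfolding test_approx_def
  proof (intro conjI allI impI hL)
    fix e :: real assume "0 < e"
    then have e: "0 < e / 2" by simp
    obtain i where i: "l2_norm (\<lambda>x. h x - H i x) < e / 2"
      using order_tendstoD(2)[OF \<open>(\<lambda>i. l2_norm (\<lambda>x. h x - H i x)) \<longlonglongrightarrow> 0\<close> e]
      by (auto simp: eventually_sequentially)
    obtain \<psi> where p: "\<psi> \<in> test_functions" "l2_norm (\<lambda>x. H i x - \<psi> x) < e / 2"
      by (rule test_approxE[OF H e])
    have "l2_norm (\<lambda>x. (h x - H i x) + (H i x - \<psi> x)) \<le> l2_norm (\<lambda>x. h x - H i x) + l2_norm (\<lambda>x. H i x - \<psi> x)"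
      by (intro l2_norm_triangle L2_diff test_approx_L2 H hL test_L2 p)
    then have "l2_norm (\<lambda>x. h x - \<psi> x) < e"
      using p i by simp
    then show "\<exists>\<psi>\<in>test_functions. l2_norm (\<lambda>x. h x - \<psi> x) < e"
      using p(1) by (rule rev_bexI[rotated])
  qed
qed

lemma test_approx_indicator_box: "test_approx (\<lambda>x. indicator (box a b) x)"
proof (rule test_approx_limit)
  show "test_approx (\<lambda>x. complex_of_real (bump (real (Suc i)) a b x))" for i
    by (intro test_approx_test bump_test) simp
  show "(\<lambda>x. indicator (box a b) x :: real) \<in> L2"
    by (rule L2_indicator) auto
  show "norm (complex_of_real (bump (real (Suc i)) a b x)) \<le> indicator (box a b) x" for i x
    using bump_pos_iff[of "real (Suc i)" a b x] bump_bounds[of "real (Suc i)" a b x]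
    by (auto simp: indicator_def)
  have "(\<lambda>i. complex_of_real (bump (real (Suc i)) a b x)) \<longlonglongrightarrow> complex_of_real (indicator (box a b) x)" for x
    by (intro tendsto_of_real bump_tendsto)
  then show "(\<lambda>i. complex_of_real (bump (real (Suc i)) a b x)) \<longlonglongrightarrow> indicator (box a b) x" for x
    by (simp only: of_real_indicator)
qed (intro borel_measurable_indicator sets_completionI_sets, simp)

text \<open>Open boxes generate the Borel sets and are stable under intersection, so Dynkin's
  induction over complements and disjoint unions applies. The fixed box keeps all indicators below a
  single L2 function, as the limit in the union case requires.\<close>

lemma test_approx_indicator_Int_box:
  assumes "A \<in> sets borel"
  shows "test_approx (\<lambda>x. indicator (A \<inter> box a b) x)"
proof -
  let ?G = "range (\<lambda>(a, b). box a b) :: (real ^ 'a) set set"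
  have s: "sets borel = sigma_sets UNIV ?G"
    by (simp add: borel_eq_box)
  have "Int_stable ?G"
    by (auto simp: Int_stable_def box_Int_box)
  moreover have "?G \<subseteq> Pow UNIV" by simp
  moreover have "A \<in> sigma_sets UNIV ?G" using assms s by simp
  ultimately show ?thesis
  proof (induction rule: sigma_sets_induct_disjoint)
    case (basic A)
    then obtain c d where "A = box c d" by auto
    then show ?case using test_approx_indicator_box by (auto simp: box_Int_box)
  next
    case empty
    then show ?case using test_approx_test[OF test_zero] by simp
  next
    case (compl A)
    have "test_approx (\<lambda>x. indicator (box a b) x + (- 1) * indicator (A \<inter> box a b) x)"
      by (intro test_approx_add test_approx_cmult compl test_approx_indicator_box)
    moreover have "(\<lambda>x. indicator (box a b) x + (- 1) * indicator (A \<inter> box a b) x)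
        = (\<lambda>x. indicator ((UNIV - A) \<inter> box a b) x :: complex)"
      by (auto simp: fun_eq_iff indicator_def)
    ultimately show ?case by simp
  next
    case (union A)
    have d: "(\<Sum>j<i. indicator (A j \<inter> box a b) x) = (indicator (\<Union>j<i. A j \<inter> box a b) x :: complex)" for i x
      using union(1) by (subst indicator_UN_disjoint) (auto simp: disjoint_family_on_def)
    show ?case
    proof (rule test_approx_limit)
      show "test_approx (\<lambda>x. \<Sum>j<i. indicator (A j \<inter> box a b) x)" for i
        by (intro test_approx_sum union) simp
      show "(\<lambda>x. indicator (box a b) x :: real) \<in> L2"
        by (rule L2_indicator) auto
      show "norm (\<Sum>j<i. indicator (A j \<inter> box a b) x :: complex) \<le> indicator (box a b) x" for i x
        unfolding d by (auto simp: indicator_def)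
      have "(\<Union>i. A i) \<in> sets borel"
        using union(2) unfolding s[symmetric] by (rule sets.countable_UN)
      then show "(\<lambda>x. indicator ((\<Union>i. A i) \<inter> box a b) x :: complex) \<in> borel_measurable lebesgue"
        by (intro borel_measurable_indicator sets_completionI_sets) auto
      show "(\<lambda>i. \<Sum>j<i. indicator (A j \<inter> box a b) x :: complex) \<longlonglongrightarrow> indicator ((\<Union>i. A i) \<inter> box a b) x" for x
        unfolding d
      proof (rule tendsto_eventually)
        show "\<forall>\<^sub>F i in sequentially. indicator (\<Union>j<i. A j \<inter> box a b) x
            = (indicator ((\<Union>i. A i) \<inter> box a b) x :: complex)"
        proof (cases "\<exists>j. x \<in> A j")
          case True
          then obtain j where "x \<in> A j" ..
          then show ?thesis
            by (auto simp: eventually_sequentially indicator_def intro!: exI[of _ "Suc j"])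
        qed (auto simp: indicator_def)
      qed
    qed
  qed
qed

text \<open>Passes from Lebesgue to Borel measurable functions: the approximation by boxes and the
  Fubini argument below both work with Borel functions.\<close>

lemma completion_ex_borel_measurable_complex:
  fixes f :: "'a \<Rightarrow> complex"
  assumes "f \<in> borel_measurable (completion N)"
  obtains f' where "f' \<in> borel_measurable N" "AE x in N. f x = f' x"
proof -
  have "(\<lambda>x. Re (f x)) \<in> borel_measurable (completion N)" "(\<lambda>x. Im (f x)) \<in> borel_measurable (completion N)"
    using assms by measurable
  from this[THEN completion_ex_borel_measurable_real]
  obtain u v where [measurable]: "u \<in> borel_measurable N" "v \<in> borel_measurable N"
    and ae: "AE x in N. Re (f x) = u x" "AE x in N. Im (f x) = v x"
    by blast
  show ?thesis
  proof
    show "(\<lambda>x. Complex (u x) (v x)) \<in> borel_measurable N"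
      unfolding Complex_eq by measurable
    show "AE x in N. f x = Complex (u x) (v x)"
      using ae by eventually_elim (simp add: complex_eq_iff)
  qed
qed

lemma test_approx_AE_cong:
  assumes f: "test_approx f" and ae: "f =\<^sub>a\<^sub>e g"
  shows "test_approx g"
  unfolding test_approx_def
proof (intro conjI allI impI)
  show g: "g \<in> L2" by (rule L2_AE_cong[OF test_approx_L2[OF f] ae])
  fix e :: real assume "0 < e"
  obtain \<psi> where p: "\<psi> \<in> test_functions" "l2_norm (\<lambda>x. f x - \<psi> x) < e"
    by (rule test_approxE[OF f \<open>0 < e\<close>])
  have "l2_norm (\<lambda>x. g x - \<psi> x) = l2_norm (\<lambda>x. f x - \<psi> x)"
  proof (rule l2_norm_AE_cong)
    show "AE x in lebesgue. g x - \<psi> x = f x - \<psi> x"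
      using ae by eventually_elim simp
  qed (intro L2_diff g test_L2 p test_approx_L2 f)+
  then show "\<exists>\<psi>\<in>test_functions. l2_norm (\<lambda>x. g x - \<psi> x) < e"
    using p by (intro bexI[of _ \<psi>]) auto
qed

text \<open>Simple functions bounded by 2 |h'| converge pointwise to a Borel representative h'.
  Cutting them off to growing boxes turns them into finite combinations of the indicators already
  treated.\<close>

lemma test_approx_all:
  fixes h :: "real ^ 'n \<Rightarrow> complex"
  assumes "h \<in> L2"
  shows "test_approx h"
proof -
  obtain h' where m: "h' \<in> borel_measurable lborel" and ae': "AE x in lborel. h x = h' x"
    by (rule completion_ex_borel_measurable_complex[OF L2_measurable[OF assms]])
  have ae: "h =\<^sub>a\<^sub>e h'" using ae' by (rule AE_completion)
  have h': "h' \<in> L2" by (rule L2_AE_cong[OF assms ae])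
  obtain F where F: "\<And>i. simple_function lborel (F i)"
    and lim: "\<And>x. (\<lambda>i. F i x) \<longlonglongrightarrow> h' x" and le: "\<And>i x. norm (F i x) \<le> 2 * norm (h' x)"
    using borel_measurable_implies_sequence_metric[OF m, of 0] by (auto simp: dist_norm)
  define B where "B i = box (- (\<Sum>b\<in>Basis. real i *\<^sub>R b)) (\<Sum>b\<in>Basis. real i *\<^sub>R b :: real ^ 'n)" for i
  have Bev: "eventually (\<lambda>i. x \<in> B i) sequentially" for x
  proof -
    obtain N :: nat where "norm x < real N" using reals_Archimedean2 by blast
    then have "x \<in> B i" if "N \<le> i" for i
      using that Basis_le_norm[of _ x] by (auto simp: B_def mem_box inner_minus_left abs_less_iff) (smt (verit) of_nat_le_iff)+
    then show ?thesis by (auto simp: eventually_sequentially)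
  qed
  have "test_approx h'"
  proof (rule test_approx_limit)
    show "test_approx (\<lambda>x. indicator (B i) x * F i x)" for i
    proof -
      have "(\<lambda>x. indicator (B i) x * F i x) = (\<lambda>x. \<Sum>y\<in>F i ` UNIV. y * indicator (F i -` {y} \<inter> B i) x)"
      proof
        fix x
        have fin: "finite (F i ` UNIV)" using simple_functionD(1)[OF F[of i]] by simp
        have "(\<Sum>y\<in>F i ` UNIV. y * indicator (F i -` {y} \<inter> B i) x)
            = (\<Sum>y\<in>F i ` UNIV. if F i x = y then y * indicator (B i) x else 0)"
          by (intro sum.cong) (auto simp: indicator_def)
        also have "\<dots> = indicator (B i) x * F i x"
          using fin by (simp add: mult.commute)
        finally show "indicator (B i) x * F i x = (\<Sum>y\<in>F i ` UNIV. y * indicator (F i -` {y} \<inter> B i) x)" ..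
      qed
      moreover have "test_approx (\<lambda>x. \<Sum>y\<in>F i ` UNIV. y * indicator (F i -` {y} \<inter> B i) x)"
        unfolding B_def
      proof (intro test_approx_sum test_approx_cmult test_approx_indicator_Int_box)
        show "F i -` {y} \<in> sets borel" for y
          using simple_functionD(2)[OF F[of i], of "{y}"] by simp
        show "finite (F i ` UNIV)" using simple_functionD(1)[OF F[of i]] by simp
      qed
      ultimately show ?thesis by (simp only:)
    qed
    show "(\<lambda>x. 2 * norm (h' x)) \<in> L2"
    proof (rule L2_dominated[OF h'])
      show "(\<lambda>x. 2 * norm (h' x)) \<in> borel_measurable lebesgue"
        using L2_measurable[OF h'] by measurable
      show "AE x in lebesgue. norm (2 * norm (h' x)) \<le> 2 * norm (h' x)" by simp
    qed
    show "norm (indicator (B i) x * F i x) \<le> 2 * norm (h' x)" for i x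
      using le[of i x] by (auto simp: norm_mult indicator_def)
    show "(\<lambda>i. indicator (B i) x * F i x) \<longlonglongrightarrow> h' x" for x
      by (rule Lim_transform_eventually[OF lim]) (use Bev[of x] in \<open>auto elim: eventually_mono\<close>)
  qed (rule L2_measurable[OF h'])
  then show ?thesis
    by (rule test_approx_AE_cong) (use ae in \<open>auto elim: AE_mp\<close>)
qed

lemma L2_test_dense:
  assumes "h \<in> L2" "0 < e"
  obtains \<psi> where "\<psi> \<in> test_functions" "l2_norm (\<lambda>x. h x - \<psi> x) < e"
  by (rule test_approxE[OF test_approx_all[OF assms(1)] assms(2)])

text \<open>The pairing is bilinear, so \<psi> is chosen close to conj h: then ||h||^2 is the
  integral of h (conj h - \<psi>), hence at most ||h|| e for every e > 0.\<close>

lemma test_orthogonal_imp_zero: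
  assumes h: "h \<in> L2" and z: "\<And>\<psi>. \<psi> \<in> test_functions \<Longrightarrow> (LINT x|lebesgue. h x * \<psi> x) = 0"
  shows "h =\<^sub>a\<^sub>e (\<lambda>_. 0)"
proof -
  have le: "(l2_norm h)\<^sup>2 \<le> l2_norm h * e" if e: "0 < e" for e
  proof -
    obtain \<psi> where p: "\<psi> \<in> test_functions" "l2_norm (\<lambda>x. cnj (h x) - \<psi> x) < e"
      by (rule L2_test_dense[OF L2_cnj[OF h] e])
    have "complex_of_real ((l2_norm h)\<^sup>2) = (LINT x|lebesgue. h x * cnj (h x))"
      unfolding l2_norm_sq integral_complex_of_real[symmetric] complex_norm_square ..
    also have "\<dots> = (LINT x|lebesgue. h x * (cnj (h x) - \<psi> x))"
      using L2_mult_integrable[OF h L2_cnj[OF h]] L2_mult_integrable[OF h test_L2[OF p(1)]] z[OF p(1)]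
      by (simp add: right_diff_distrib)
    finally have "norm (complex_of_real ((l2_norm h)\<^sup>2)) = norm (LINT x|lebesgue. h x * (cnj (h x) - \<psi> x))"
      by simp
    also have "\<dots> \<le> l2_norm h * l2_norm (\<lambda>x. cnj (h x) - \<psi> x)"
      by (intro L2_Cauchy_Schwarz h L2_diff L2_cnj test_L2 p)
    also have "\<dots> \<le> l2_norm h * e"
      using p(2) by (intro mult_left_mono l2_norm_nonneg) simp
    finally show ?thesis by (simp only: norm_of_real abs_power2)
  qed
  have "l2_norm h = 0"
  proof (rule ccontr)
    assume "l2_norm h \<noteq> 0"
    then have "0 < l2_norm h" using l2_norm_nonneg[of h] by simp
    \<comment> \<open>The choice e = ||h|| / 2 would give ||h||^2 at most half of itself.\<close>
    then show False using le[of "l2_norm h / 2"] by (simp add: power2_eq_square)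
  qed
  then show ?thesis by (simp add: l2_norm_eq_0_iff[OF h])
qed

subsection \<open>Locally square integrable functions\<close>

text \<open>Accommodates nonzero constants and products such as \<open>gauss (- w) x * f x\<close>,
  which need not be square integrable. Balls about the origin suffice, since every bounded set lies
  in one.\<close>

definition L2_loc :: "('a::euclidean_space \<Rightarrow> complex) \<Rightarrow> bool"
  where "L2_loc f \<longleftrightarrow> f \<in> borel_measurable lebesgue \<and> (\<forall>r. (\<lambda>x. indicator (cball 0 r) x * f x) \<in> L2)"

lemma L2_loc_measurable: "L2_loc f \<Longrightarrow> f \<in> borel_measurable lebesgue"
  by (simp add: L2_loc_def)

lemma L2_loc_indicator: "L2_loc f \<Longrightarrow> (\<lambda>x. indicator (cball 0 r) x * f x) \<in> L2"
  by (simp add: L2_loc_def)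

lemma borel_measurable_indicator_cball:
  "indicator (cball 0 r) \<in> borel_measurable (lebesgue :: 'a::euclidean_space measure)"
  by (intro borel_measurable_indicator sets_completionI_sets) simp

lemma L2_imp_L2_loc:
  assumes "f \<in> L2"
  shows "L2_loc f"
  unfolding L2_loc_def
proof (intro conjI allI)
  show m: "f \<in> borel_measurable lebesgue" by (rule L2_measurable[OF assms])
  show "(\<lambda>x. indicator (cball 0 r) x * f x) \<in> L2" for r
  proof (rule L2_dominated[OF assms])
    show "(\<lambda>x. indicator (cball 0 r) x * f x) \<in> borel_measurable lebesgue"
      by (intro borel_measurable_times borel_measurable_indicator_cball m)
    show "AE x in lebesgue. norm (indicator (cball 0 r) x * f x) \<le> 1 * norm (f x)"
      by (simp add: indicator_def norm_mult)
  qed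
qed

lemma L2_loc_mult_continuous:
  assumes f: "L2_loc f" and g: "continuous_on UNIV g"
  shows "L2_loc (\<lambda>x. g x * f x)"
  unfolding L2_loc_def
proof (intro conjI allI)
  show m: "(\<lambda>x. g x * f x) \<in> borel_measurable lebesgue"
    by (intro borel_measurable_times borel_measurable_lebesgue_continuous g L2_loc_measurable f)
  fix r
  have "compact (g ` cball 0 r)"
    using g by (intro compact_continuous_image) (auto intro: continuous_on_subset)
  then obtain c where c: "\<And>x. x \<in> cball 0 r \<Longrightarrow> norm (g x) \<le> c"
    using compact_imp_bounded bounded_pos by (metis imageI)
  show "(\<lambda>x. indicator (cball 0 r) x * (g x * f x)) \<in> L2"
  proof (rule L2_dominated[OF L2_loc_indicator[OF f]])
    show "(\<lambda>x. indicator (cball 0 r) x * (g x * f x)) \<in> borel_measurable lebesgue"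
      by (intro borel_measurable_times borel_measurable_indicator_cball m)
    have "norm (indicator (cball 0 r) x * (g x * f x)) \<le> c * norm (indicator (cball 0 r) x * f x)" for x
      using c[of x] by (auto simp: indicator_def norm_mult intro!: mult_right_mono)
    then show "AE x in lebesgue. norm (indicator (cball 0 r) x * (g x * f x)) \<le> c * norm (indicator (cball 0 r) x * f x)"
      by simp
  qed
qed

lemma L2_loc_const: "L2_loc (\<lambda>_. c)"
  unfolding L2_loc_def
proof (intro conjI allI)
  show "(\<lambda>x. indicator (cball 0 r) x * c) \<in> L2" for r
  proof (rule L2_dominated[OF L2_indicator])
    show "(\<lambda>x. indicator (cball 0 r) x * c) \<in> borel_measurable lebesgue"
      by (intro borel_measurable_times borel_measurable_indicator_cball) simp
    show "AE x in lebesgue. norm (indicator (cball 0 r) x * c) \<le> norm c * norm (indicator (cball 0 r) x :: real)"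
      by (simp add: indicator_def)
  qed auto
qed simp

lemma L2_loc_diff:
  assumes "L2_loc f" "L2_loc g"
  shows "L2_loc (\<lambda>x. f x - g x)"
  unfolding L2_loc_def
proof (intro conjI allI)
  show "(\<lambda>x. f x - g x) \<in> borel_measurable lebesgue"
    by (intro borel_measurable_diff L2_loc_measurable assms)
  show "(\<lambda>x. indicator (cball 0 r) x * (f x - g x)) \<in> L2" for r
    unfolding right_diff_distrib by (intro L2_diff L2_loc_indicator assms)
qed

lemma L2_loc_translate:
  assumes f: "L2_loc f"
  shows "L2_loc (\<lambda>x. f (x + a))"
  unfolding L2_loc_def
proof (intro conjI allI)
  show m: "(\<lambda>x. f (x + a)) \<in> borel_measurable lebesgue"
    by (rule borel_measurable_translate[OF L2_loc_measurable[OF f]])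
  fix r
  show "(\<lambda>x. indicator (cball 0 r) x * f (x + a)) \<in> L2"
  \<comment> \<open>If |x| is at most r, then |x + a| is at most r + |a|, so the enlarged ball does
    not cut off anything that is needed.\<close>
  proof (rule L2_dominated[OF L2_translate[OF L2_loc_indicator[OF f, of "r + norm a"], of a]])
    show "(\<lambda>x. indicator (cball 0 r) x * f (x + a)) \<in> borel_measurable lebesgue"
      by (intro borel_measurable_times borel_measurable_indicator_cball m)
    have "norm (indicator (cball 0 r) x * f (x + a))
        \<le> 1 * norm (indicator (cball 0 (r + norm a)) (x + a) * f (x + a))" for x
      using norm_triangle_ineq[of x a] by (auto simp: indicator_def)
    then show "AE x in lebesgue. norm (indicator (cball 0 r) x * f (x + a))
        \<le> 1 * norm (indicator (cball 0 (r + norm a)) (x + a) * f (x + a))"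
      by simp
  qed
qed

lemma L2_loc_mult_test:
  assumes f: "L2_loc f" and p: "\<psi> \<in> test_functions"
  shows "(\<lambda>x. f x * \<psi> x) \<in> L2" "integrable lebesgue (\<lambda>x. f x * \<psi> x)"
proof -
  obtain c r where cr: "0 \<le> c" "0 < r" "\<And>x. norm (\<psi> x) \<le> c * indicator (cball 0 r) x"
    by (rule test_bounded[OF p]) blast
  \<comment> \<open>\<psi> vanishes off the ball, so the cutoff can be inserted without change and f
    is replaced by an L2 function.\<close>
  have e: "(\<lambda>x. indicator (cball 0 r) x * f x * \<psi> x) = (\<lambda>x. f x * \<psi> x)"
  proof
    show "indicator (cball 0 r) x * f x * \<psi> x = f x * \<psi> x" for x
      using cr(3)[of x] by (auto simp: indicator_def)
  qed
  show "integrable lebesgue (\<lambda>x. f x * \<psi> x)"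
    using L2_mult_integrable[OF L2_loc_indicator[OF f, of r] test_L2[OF p]] unfolding e .
  have "norm (\<psi> x) \<le> c" for x
    using cr(1) cr(3)[of x] by (cases "norm x \<le> r") (auto simp: indicator_def)
  from L2_mult_bounded[OF L2_loc_indicator[OF f, of r] test_measurable[OF p] this]
  show "(\<lambda>x. f x * \<psi> x) \<in> L2" unfolding e .
qed

text \<open>Bumps on growing boxes reduce this to L2: \<open>b i\<close> times a test function is
  again one, so f times \<open>b i\<close> is orthogonal to all of them and vanishes. Countably many
  boxes cover the space, and \<open>b i\<close> is nonzero throughout its box.\<close>

lemma L2_loc_orthogonal_imp_zero:
  fixes f :: "real ^ 'n \<Rightarrow> complex"
  assumes f: "L2_loc f" and z: "\<And>\<psi>. \<psi> \<in> test_functions \<Longrightarrow> (LINT x|lebesgue. f x * \<psi> x) = 0"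
  shows "f =\<^sub>a\<^sub>e (\<lambda>_. 0)"
proof -
  define b where "b i x = complex_of_real (bump 1 (- (\<chi> j. real i)) (\<chi> j. real i) x)" for i and x :: "real ^ 'n"
  have bt: "b i \<in> test_functions" for i
    unfolding b_def[abs_def] by (rule bump_test) simp
  have "AE x in lebesgue. f x * b i x = 0" for i
  proof (rule test_orthogonal_imp_zero[OF L2_loc_mult_test(1)[OF f bt]])
    fix \<psi> :: "real ^ 'n \<Rightarrow> complex" assume "\<psi> \<in> test_functions"
    from z[OF test_mult[OF this test_C_k[OF bt[of i]]]]
    show "(LINT x|lebesgue. f x * b i x * \<psi> x) = 0" by (simp add: mult.assoc)
  qed
  then have "AE x in lebesgue. \<forall>i. f x * b i x = 0"
    by (simp only: AE_all_countable) blast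
  then show ?thesis
  proof eventually_elim
    case (elim x)
    obtain i :: nat where i: "norm x < real i" using reals_Archimedean2 by blast
    have "\<bar>x $ j\<bar> < real i" for j
      using component_le_norm_cart[of x j] i by linarith
    then have "x \<in> box (- (\<chi> j. real i)) (\<chi> j. real i)"
      by (auto simp: mem_box_cart abs_less_iff) (smt (verit))
    then have "b i x \<noteq> 0"
      using bump_pos_iff[of 1 "- (\<chi> j. real i)" "\<chi> j. real i" x] by (simp add: b_def)
    then show "f x = 0" using elim by auto
  qed
qed

subsection \<open>Differentiation under the integral sign\<close>

lemma has_vector_derivative_iff_quotient:
  fixes f :: "real \<Rightarrow> 'a::real_normed_vector"
  shows "(f has_vector_derivative D) (at s) \<longleftrightarrow> ((\<lambda>h. (f (s + h) - f s) /\<^sub>R h) \<longlongrightarrow> D) (at 0)"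
proof -
  have e: "norm (f (s + h) - f s - h *\<^sub>R D) / norm h = norm ((f (s + h) - f s) /\<^sub>R h - D)" if "h \<noteq> 0" for h
  proof -
    have "(f (s + h) - f s) /\<^sub>R h - D = (f (s + h) - f s - h *\<^sub>R D) /\<^sub>R h"
      using that by (simp add: scaleR_diff_right)
    then show ?thesis by (simp add: divide_inverse mult.commute)
  qed
  have "(f has_vector_derivative D) (at s) \<longleftrightarrow> ((\<lambda>h. norm (f (s + h) - f s - h *\<^sub>R D) / norm h) \<longlongrightarrow> 0) (at 0)"
    by (simp add: has_vector_derivative_def has_derivative_at bounded_linear_scaleR_left)
  also have "\<dots> \<longleftrightarrow> ((\<lambda>h. norm ((f (s + h) - f s) /\<^sub>R h - D)) \<longlongrightarrow> 0) (at 0)"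
    using e by (intro tendsto_cong) (simp add: eventually_at_filter)
  also have "\<dots> \<longleftrightarrow> ((\<lambda>h. (f (s + h) - f s) /\<^sub>R h) \<longlongrightarrow> D) (at 0)"
    by (simp add: tendsto_norm_zero_iff LIM_zero_iff)
  finally show ?thesis .
qed

text \<open>A mean value inequality, used for bounds on difference quotients and, with c = 0, for
  constancy.\<close>

lemma vector_derivative_Lipschitz:
  fixes f :: "real \<Rightarrow> 'a::real_normed_vector"
  assumes "\<And>t. (f has_vector_derivative f' t) (at t)" "\<And>t. norm (f' t) \<le> c"
  shows "norm (f t - f s) \<le> c * \<bar>t - s\<bar>"
proof -
  have "norm (f t - f s) \<le> c * norm (t - s)"
  proof (rule differentiable_bound[where S=UNIV])
    show "(f has_derivative (\<lambda>h. h *\<^sub>R f' u)) (at u within UNIV)" for u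
      using assms(1) by (simp add: has_vector_derivative_def)
    show "onorm (\<lambda>h. h *\<^sub>R f' u) \<le> c" for u
      using assms(2)[of u] by (intro onorm_le) (simp add: mult.commute[of c] mult_left_mono)
  qed auto
  then show ?thesis by simp
qed

lemma test_line_derivative:
  assumes "\<psi> \<in> test_functions"
  shows "((\<lambda>s. \<psi> (x + s *\<^sub>R axis j 1)) has_vector_derivative partial j \<psi> (x + s *\<^sub>R axis j 1)) (at s)"
proof -
  let ?D = "frechet_derivative \<psi> (at (x + s *\<^sub>R axis j 1))"
  have D: "(\<psi> has_derivative ?D) (at (x + s *\<^sub>R axis j 1))"
    by (rule has_derivative_partial[OF test_differentiable[OF assms]])
  have "((\<lambda>s. x + s *\<^sub>R axis j 1) has_derivative (\<lambda>h. h *\<^sub>R axis j 1)) (at s)"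
    by (auto intro!: derivative_eq_intros)
  from has_derivative_compose[OF this D]
  have "((\<lambda>s. \<psi> (x + s *\<^sub>R axis j 1)) has_derivative (\<lambda>h. ?D (h *\<^sub>R axis j 1))) (at s)" .
  moreover have "?D (h *\<^sub>R axis j 1) = h *\<^sub>R partial j \<psi> (x + s *\<^sub>R axis j 1)" for h
    using linear_scale[OF has_derivative_linear[OF D]] by (simp add: partial_def)
  ultimately show ?thesis by (simp add: has_vector_derivative_def)
qed

text \<open>Only \<psi> is differentiated, so f may be rough. Along a null sequence of steps the
  quotients of \<psi> are uniformly bounded, by the mean value inequality, and vanish off one ball;
  dominated convergence applies.\<close>

lemma integral_mult_test_derivative_0:
  fixes f :: "real ^ 'n \<Rightarrow> complex"
  assumes f: "L2_loc f" and p: "\<psi> \<in> test_functions"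
  shows "((\<lambda>s. LINT x|lebesgue. f x * \<psi> (x + s *\<^sub>R axis j 1)) has_vector_derivative
    (LINT x|lebesgue. f x * partial j \<psi> x)) (at 0)"
  unfolding has_vector_derivative_iff_quotient tendsto_at_iff_sequentially
proof (intro allI impI)
  fix X :: "nat \<Rightarrow> real" assume X: "\<forall>i. X i \<in> UNIV - {0}" "X \<longlonglongrightarrow> 0"
  let ?e = "axis j 1 :: real ^ 'n"
  obtain c r where cr: "0 \<le> c" "0 < r" "\<And>x. norm (partial j \<psi> x) \<le> c * indicator (cball 0 r) x"
    by (rule test_bounded[OF test_partial[OF p]]) blast
  have c: "norm (partial j \<psi> x) \<le> c" for x
    using cr(1) cr(3)[of x] by (cases "norm x \<le> r") (auto simp: indicator_def)
  obtain c' r' where cr': "0 \<le> c'" "0 < r'" "\<And>x. norm (\<psi> x) \<le> c' * indicator (cball 0 r') x"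
    by (rule test_bounded[OF p]) blast
  \<comment> \<open>A bound for the steps: the shifted supports then all lie in the ball of radius
    r' + R.\<close>
  obtain R where R: "\<And>i. \<bar>X i\<bar> \<le> R"
    using convergent_imp_Bseq[OF convergentI[OF X(2)]] by (auto simp: Bseq_def)
  have R0: "0 \<le> R" using R[of 0] by linarith
  have lip: "norm (\<psi> (x + s *\<^sub>R ?e) - \<psi> x) \<le> c * \<bar>s\<bar>" for x s
    using vector_derivative_Lipschitz[OF test_line_derivative[OF p, of x j] c, of s 0] by simp
  have bnd: "norm ((\<psi> (x + X i *\<^sub>R ?e) - \<psi> x) /\<^sub>R X i) \<le> c * indicator (cball 0 (r' + R)) x" for x i
  proof (cases "x \<in> cball 0 (r' + R)")
    case True
    have "X i \<noteq> 0" using X(1) by simp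
    have "norm ((\<psi> (x + X i *\<^sub>R ?e) - \<psi> x) /\<^sub>R X i) = norm (\<psi> (x + X i *\<^sub>R ?e) - \<psi> x) / \<bar>X i\<bar>"
      by (simp add: divide_inverse mult.commute)
    also have "\<dots> \<le> (c * \<bar>X i\<bar>) / \<bar>X i\<bar>"
      by (intro divide_right_mono lip) simp
    finally show ?thesis using True \<open>X i \<noteq> 0\<close> by simp
  next
    case False
    then have n: "r' + R < norm x" by simp
    have "norm x - \<bar>X i\<bar> \<le> norm (x + X i *\<^sub>R ?e)"
      using norm_triangle_ineq4[of "x + X i *\<^sub>R ?e" "X i *\<^sub>R ?e"] by simp
    then have "r' < norm (x + X i *\<^sub>R ?e)" using n R[of i] by linarith
    then have "\<psi> (x + X i *\<^sub>R ?e) = 0" using cr'(3)[of "x + X i *\<^sub>R ?e"] by (simp add: indicator_def)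
    moreover have "\<psi> x = 0" using cr'(3)[of x] n R0 by (simp add: indicator_def)
    ultimately show ?thesis using False by simp
  qed
  have ts: "(\<lambda>x. \<psi> (x + s *\<^sub>R ?e)) \<in> test_functions" for s
    by (rule test_translate[OF p])
  have quot: "((LINT x|lebesgue. f x * \<psi> (x + (0 + X i) *\<^sub>R ?e)) - (LINT x|lebesgue. f x * \<psi> (x + 0 *\<^sub>R ?e))) /\<^sub>R X i
      = (LINT x|lebesgue. f x * ((\<psi> (x + X i *\<^sub>R ?e) - \<psi> x) /\<^sub>R X i))" for i
    using L2_loc_mult_test(2)[OF f ts[of "X i"]] L2_loc_mult_test(2)[OF f p]
    by (simp add: right_diff_distrib scaleR_diff_right)
  have "(\<lambda>i. LINT x|lebesgue. f x * ((\<psi> (x + X i *\<^sub>R ?e) - \<psi> x) /\<^sub>R X i))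
      \<longlonglongrightarrow> (LINT x|lebesgue. f x * partial j \<psi> x)"
  proof (rule Bochner_Integration.integral_dominated_convergence
      [where w="\<lambda>x. c * (norm (indicator (cball 0 (r' + R)) x * f x) * norm (indicator (cball 0 (r' + R)) x :: real))"])
    show "(\<lambda>x. f x * partial j \<psi> x) \<in> borel_measurable lebesgue"
      by (intro borel_measurable_integrable L2_loc_mult_test(2)[OF f] test_partial p)
    show "(\<lambda>x. f x * ((\<psi> (x + X i *\<^sub>R ?e) - \<psi> x) /\<^sub>R X i)) \<in> borel_measurable lebesgue" for i
      by (intro borel_measurable_times borel_measurable_scaleR borel_measurable_diff borel_measurable_const
          L2_loc_measurable[OF f] test_measurable p ts)
    \<comment> \<open>The indicator occurs twice so that the majorant, which is |f| on the ball, is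
      a product of two L2 functions.\<close>
    have "integrable lebesgue (\<lambda>x. norm (indicator (cball 0 (r' + R)) x * f x) * norm (indicator (cball 0 (r' + R)) x :: real))"
      by (rule L2_prod_norm_integrable[OF L2_loc_indicator[OF f] L2_indicator]) auto
    then show "integrable lebesgue (\<lambda>x. c * (norm (indicator (cball 0 (r' + R)) x * f x) * norm (indicator (cball 0 (r' + R)) x :: real)))"
      by (rule Bochner_Integration.integrable_mult_right)
    show "AE x in lebesgue. (\<lambda>i. f x * ((\<psi> (x + X i *\<^sub>R ?e) - \<psi> x) /\<^sub>R X i)) \<longlonglongrightarrow> f x * partial j \<psi> x"
    proof (rule AE_I2)
      fix x
      have "((\<lambda>h. (\<psi> (x + h *\<^sub>R ?e) - \<psi> x) /\<^sub>R h) \<longlongrightarrow> partial j \<psi> x) (at 0)"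
        using test_line_derivative[OF p, of x j 0] by (simp add: has_vector_derivative_iff_quotient)
      moreover have "filterlim X (at 0) sequentially"
        using X by (auto simp: filterlim_at)
      ultimately have "(\<lambda>i. (\<psi> (x + X i *\<^sub>R ?e) - \<psi> x) /\<^sub>R X i) \<longlonglongrightarrow> partial j \<psi> x"
        by (rule filterlim_compose)
      then show "(\<lambda>i. f x * ((\<psi> (x + X i *\<^sub>R ?e) - \<psi> x) /\<^sub>R X i)) \<longlonglongrightarrow> f x * partial j \<psi> x"
        by (rule tendsto_mult_left)
    qed
    show "AE x in lebesgue. norm (f x * ((\<psi> (x + X i *\<^sub>R ?e) - \<psi> x) /\<^sub>R X i))
        \<le> c * (norm (indicator (cball 0 (r' + R)) x * f x) * norm (indicator (cball 0 (r' + R)) x :: real))" for i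
    proof (rule AE_I2)
      fix x
      have "norm (f x * ((\<psi> (x + X i *\<^sub>R ?e) - \<psi> x) /\<^sub>R X i)) \<le> norm (f x) * (c * indicator (cball 0 (r' + R)) x)"
        unfolding norm_mult by (intro mult_left_mono bnd norm_ge_zero)
      then show "norm (f x * ((\<psi> (x + X i *\<^sub>R ?e) - \<psi> x) /\<^sub>R X i))
        \<le> c * (norm (indicator (cball 0 (r' + R)) x * f x) * norm (indicator (cball 0 (r' + R)) x :: real))"
        by (auto simp: indicator_def mult.commute)
    qed
  qed
  then show "((\<lambda>h. ((LINT x|lebesgue. f x * \<psi> (x + (0 + h) *\<^sub>R ?e)) - (LINT x|lebesgue. f x * \<psi> (x + 0 *\<^sub>R ?e))) /\<^sub>R h) \<circ> X)
      \<longlonglongrightarrow> (LINT x|lebesgue. f x * partial j \<psi> x)"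
    unfolding comp_def quot .
qed

lemma integral_mult_test_derivative:
  fixes f :: "real ^ 'n \<Rightarrow> complex"
  assumes f: "L2_loc f" and p: "\<psi> \<in> test_functions"
  shows "((\<lambda>s. LINT x|lebesgue. f x * \<psi> (x + s *\<^sub>R axis j 1)) has_vector_derivative
    (LINT x|lebesgue. f x * partial j \<psi> (x + s *\<^sub>R axis j 1))) (at s)"
proof -
  have "((\<lambda>h. LINT x|lebesgue. f x * \<psi> (x + h *\<^sub>R axis j 1 + s *\<^sub>R axis j 1)) has_vector_derivative
    (LINT x|lebesgue. f x * partial j \<psi> (x + s *\<^sub>R axis j 1))) (at 0)"
    using integral_mult_test_derivative_0[OF f test_translate[OF p, of "s *\<^sub>R axis j 1"], of j]
    by (simp add: partial_translate[OF test_differentiable[OF p]])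
  then show ?thesis
    by (simp add: has_vector_derivative_iff_quotient algebra_simps)
qed

text \<open>By translation invariance the integral of a translate of \<psi> does not depend on the
  shift, and its derivative at shift 0 is the integral in question. This replaces iterated integrals
  and the fundamental theorem of calculus.\<close>

lemma integral_partial_test:
  assumes "\<psi> \<in> test_functions"
  shows "(LINT x|lebesgue. partial j \<psi> x) = 0"
proof -
  have "((\<lambda>s. LINT x|lebesgue. \<psi> (x + s *\<^sub>R axis j 1)) has_vector_derivative
    (LINT x|lebesgue. partial j \<psi> x)) (at 0)"
    using integral_mult_test_derivative_0[OF L2_loc_const[of 1] assms] by simp
  moreover have "(LINT x|lebesgue. \<psi> (x + s *\<^sub>R axis j 1)) = (LINT x|lebesgue. \<psi> x)" for s
    by (rule integral_translate[OF test_measurable[OF assms]])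
  ultimately show ?thesis
    by (metis (no_types, lifting) ext has_vector_derivative_const vector_derivative_unique_at)
qed

subsection \<open>Translations and weak derivatives\<close>

text \<open>The translation is moved onto \<psi>, where differentiation is classical. The reversed
  direction gives one minus sign and the definition of the weak derivative another, so g appears
  with a plus.\<close>

lemma integral_translate_test_derivative:
  fixes f g :: "real ^ 'n \<Rightarrow> complex"
  assumes f: "f \<in> L2" and w: "has_weak_partial f j g" and p: "\<psi> \<in> test_functions"
  shows "((\<lambda>t. LINT x|lebesgue. f (x + t *\<^sub>R axis j 1) * \<psi> x) has_vector_derivative
    (LINT x|lebesgue. g x * \<psi> (x - t *\<^sub>R axis j 1))) (at t)"
proof -
  let ?e = "axis j 1 :: real ^ 'n"
  have e: "(LINT x|lebesgue. f (x + t *\<^sub>R ?e) * \<psi> x) = (LINT x|lebesgue. f x * \<psi> (x + (- t) *\<^sub>R ?e))" for t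
    using integral_translate[OF borel_measurable_integrable[OF
        L2_mult_integrable[OF f test_L2[OF test_translate[OF p, of "(- t) *\<^sub>R ?e"]]]], of "t *\<^sub>R ?e"]
    by simp
  have "((\<lambda>s. LINT x|lebesgue. f x * \<psi> (x + s *\<^sub>R ?e)) \<circ> uminus has_vector_derivative
      (- 1) *\<^sub>R (LINT x|lebesgue. f x * partial j \<psi> (x + (- t) *\<^sub>R ?e))) (at t)"
    by (rule vector_diff_chain_at)
       (auto intro!: derivative_eq_intros integral_mult_test_derivative[OF L2_imp_L2_loc[OF f] p]
         has_vector_derivative_minus simp del: scaleR_minus_left)
  moreover have "(- 1) *\<^sub>R (LINT x|lebesgue. f x * partial j \<psi> (x + (- t) *\<^sub>R ?e))
      = (LINT x|lebesgue. g x * \<psi> (x - t *\<^sub>R ?e))"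
  proof -
    have "partial j (\<lambda>x. \<psi> (x + (- t) *\<^sub>R ?e)) = (\<lambda>x. partial j \<psi> (x + (- t) *\<^sub>R ?e))"
      by (intro ext partial_translate test_differentiable p)
    then show ?thesis
      using w test_translate[OF p, of "(- t) *\<^sub>R ?e"] by (auto simp: has_weak_partial_def)
  qed
  ultimately show ?thesis by (simp only: e comp_def)
qed

text \<open>The derivative in t is bounded by ||g|| ||\<psi>|| for all t, by Cauchy-Schwarz and the
  invariance of the norm. Only the L2 norm of \<psi> enters, which permits the passage to general
  h.\<close>

lemma translate_diff_bound_test:
  fixes f g :: "real ^ 'n \<Rightarrow> complex"
  assumes f: "f \<in> L2" and g: "g \<in> L2" and w: "has_weak_partial f j g" and p: "\<psi> \<in> test_functions"
  shows "norm (LINT x|lebesgue. (f (x + t *\<^sub>R axis j 1) - f x) * \<psi> x) \<le> \<bar>t\<bar> * l2_norm g * l2_norm \<psi>"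
proof -
  let ?e = "axis j 1 :: real ^ 'n"
  have "norm (LINT x|lebesgue. g x * \<psi> (x - s *\<^sub>R ?e)) \<le> l2_norm g * l2_norm \<psi>" for s
    using L2_Cauchy_Schwarz[OF g test_L2[OF test_translate[OF p, of "- (s *\<^sub>R ?e)"]]]
      l2_norm_translate[OF test_L2[OF p], of "- (s *\<^sub>R ?e)"] by simp
  from vector_derivative_Lipschitz[OF integral_translate_test_derivative[OF f w p] this, of t 0]
  show ?thesis
    using L2_mult_integrable[OF L2_translate[OF f, of "t *\<^sub>R ?e"] test_L2[OF p]]
      L2_mult_integrable[OF f test_L2[OF p]]
    by (simp add: left_diff_distrib mult.assoc mult.commute[of _ "\<bar>t\<bar>"])
qed

lemma translate_diff_bound:
  fixes f g :: "real ^ 'n \<Rightarrow> complex"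
  assumes f: "f \<in> L2" and g: "g \<in> L2" and w: "has_weak_partial f j g" and h: "h \<in> L2"
  shows "norm (LINT x|lebesgue. (f (x + t *\<^sub>R axis j 1) - f x) * h x) \<le> \<bar>t\<bar> * l2_norm g * l2_norm h"
proof -
  define u where "u x = f (x + t *\<^sub>R axis j 1) - f x" for x
  have u: "u \<in> L2" unfolding u_def[abs_def] by (intro L2_diff L2_translate f)
  \<comment> \<open>Collects both errors of replacing h by \<psi>: ||u|| from Cauchy-Schwarz for h -
    \<psi>, and |t| ||g|| from estimating ||\<psi>|| by ||h|| + ||h - \<psi>||.\<close>
  define c where "c = l2_norm u + \<bar>t\<bar> * l2_norm g"
  have c: "0 \<le> c" by (simp add: c_def l2_norm_nonneg)
  have "norm (LINT x|lebesgue. u x * h x) \<le> \<bar>t\<bar> * l2_norm g * l2_norm h + d" if d: "0 < d" for d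
  proof -
    have e: "0 < d / (c + 1)" using c d by simp
    obtain \<psi> where p: "\<psi> \<in> test_functions" "l2_norm (\<lambda>x. h x - \<psi> x) < d / (c + 1)"
      by (rule L2_test_dense[OF h e])
    note hp = L2_diff[OF h test_L2[OF p(1)]]
    have "l2_norm (\<lambda>x. h x + (-1) * (h x - \<psi> x)) \<le> l2_norm h + l2_norm (\<lambda>x. (-1) * (h x - \<psi> x))"
      by (intro l2_norm_triangle h L2_cmult hp)
    then have np: "l2_norm \<psi> \<le> l2_norm h + l2_norm (\<lambda>x. h x - \<psi> x)"
      unfolding l2_norm_cmult by simp
    have "(LINT x|lebesgue. u x * h x) = (LINT x|lebesgue. u x * \<psi> x) + (LINT x|lebesgue. u x * (h x - \<psi> x))"
      using L2_mult_integrable[OF u test_L2[OF p(1)]] L2_mult_integrable[OF u h]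
      by (simp add: right_diff_distrib)
    then have "norm (LINT x|lebesgue. u x * h x)
        \<le> norm (LINT x|lebesgue. u x * \<psi> x) + norm (LINT x|lebesgue. u x * (h x - \<psi> x))"
      by (simp add: norm_triangle_ineq)
    also have "\<dots> \<le> \<bar>t\<bar> * l2_norm g * l2_norm \<psi> + l2_norm u * l2_norm (\<lambda>x. h x - \<psi> x)"
      using translate_diff_bound_test[OF f g w p(1), of t] L2_Cauchy_Schwarz[OF u hp]
      by (simp add: u_def)
    also have "\<dots> \<le> \<bar>t\<bar> * l2_norm g * (l2_norm h + l2_norm (\<lambda>x. h x - \<psi> x)) + l2_norm u * l2_norm (\<lambda>x. h x - \<psi> x)"
      by (intro add_right_mono mult_left_mono np mult_nonneg_nonneg l2_norm_nonneg) simp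
    also have "\<dots> = \<bar>t\<bar> * l2_norm g * l2_norm h + c * l2_norm (\<lambda>x. h x - \<psi> x)"
      by (simp add: c_def algebra_simps)
    also have "c * l2_norm (\<lambda>x. h x - \<psi> x) \<le> (c + 1) * l2_norm (\<lambda>x. h x - \<psi> x)"
      by (intro mult_right_mono l2_norm_nonneg) simp
    also have "(c + 1) * l2_norm (\<lambda>x. h x - \<psi> x) \<le> d"
      using p(2) c by (simp add: pos_less_divide_eq add_nonneg_pos mult.commute)
    finally show ?thesis by simp
  qed
  then show ?thesis unfolding u_def by (rule field_le_epsilon)
qed

text \<open>The difference quotients, as functionals of h, are bounded by ||g|| uniformly in t, so
  their convergence on the dense set of test functions extends to all of L2.\<close>

lemma translate_weak_derivative:
  fixes f g :: "real ^ 'n \<Rightarrow> complex"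
  assumes f: "f \<in> L2" and g: "g \<in> L2" and w: "has_weak_partial f j g" and h: "h \<in> L2"
  shows "((\<lambda>t. LINT x|lebesgue. f (x + t *\<^sub>R axis j 1) * h x) has_vector_derivative
    (LINT x|lebesgue. g x * h x)) (at 0)"
  unfolding has_vector_derivative_iff_quotient
proof (rule tendstoI)
  let ?e = "axis j 1 :: real ^ 'n"
  define Q where "Q t k = (LINT x|lebesgue. (f (x + t *\<^sub>R ?e) - f x) * k x) /\<^sub>R t" for t k
  have Qeq: "((LINT x|lebesgue. f (x + (0 + t) *\<^sub>R ?e) * k x) - (LINT x|lebesgue. f (x + 0 *\<^sub>R ?e) * k x)) /\<^sub>R t = Q t k"
    if "k \<in> L2" for t k
    using L2_mult_integrable[OF L2_translate[OF f, of "t *\<^sub>R ?e"] that] L2_mult_integrable[OF f that]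
    by (simp add: Q_def left_diff_distrib)
  have Qb: "norm (Q t k) \<le> l2_norm g * l2_norm k" if "k \<in> L2" "t \<noteq> 0" for t k
  proof -
    have "norm (Q t k) = norm (LINT x|lebesgue. (f (x + t *\<^sub>R ?e) - f x) * k x) / \<bar>t\<bar>"
      by (simp add: Q_def divide_inverse mult.commute)
    also have "\<dots> \<le> (\<bar>t\<bar> * l2_norm g * l2_norm k) / \<bar>t\<bar>"
      by (intro divide_right_mono translate_diff_bound[OF f g w that(1)]) simp
    finally show ?thesis using that(2) by simp
  qed
  fix d :: real assume d: "0 < d"
  define c where "c = l2_norm g"
  have c: "0 \<le> c" by (simp add: c_def l2_norm_nonneg)
  \<comment> \<open>Two of the three errors are at most c ||h - \<psi>||, hence the thirds; the
    added 1 guards against c = 0.\<close>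
  have e: "0 < d / (3 * (c + 1))" using c d by simp
  obtain \<psi> where p: "\<psi> \<in> test_functions" "l2_norm (\<lambda>x. h x - \<psi> x) < d / (3 * (c + 1))"
    by (rule L2_test_dense[OF h e])
  note hp = L2_diff[OF h test_L2[OF p(1)]]
  have small: "c * l2_norm (\<lambda>x. h x - \<psi> x) < d / 3"
  proof -
    have "c * l2_norm (\<lambda>x. h x - \<psi> x) \<le> (c + 1) * l2_norm (\<lambda>x. h x - \<psi> x)"
      by (intro mult_right_mono l2_norm_nonneg) simp
    also have "\<dots> < d / 3"
      using p(2) c by (simp add: field_simps)
    finally show ?thesis .
  qed
  have "((\<lambda>t. Q t \<psi>) \<longlongrightarrow> (LINT x|lebesgue. g x * \<psi> x)) (at 0)"
    using integral_translate_test_derivative[OF f w p(1), of 0]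
    unfolding has_vector_derivative_iff_quotient Qeq[OF test_L2[OF p(1)]] by simp
  then have "\<forall>\<^sub>F t in at 0. dist (Q t \<psi>) (LINT x|lebesgue. g x * \<psi> x) < d / 3"
    by (rule tendstoD) (use d in simp)
  moreover have "\<forall>\<^sub>F t::real in at 0. t \<noteq> 0" by (simp add: eventually_at_filter)
  ultimately show "\<forall>\<^sub>F t in at 0. dist (((LINT x|lebesgue. f (x + (0 + t) *\<^sub>R ?e) * h x)
      - (LINT x|lebesgue. f (x + 0 *\<^sub>R ?e) * h x)) /\<^sub>R t) (LINT x|lebesgue. g x * h x) < d"
    unfolding Qeq[OF h]
  proof eventually_elim
    case (elim t)
    have u: "(\<lambda>x. f (x + t *\<^sub>R ?e) - f x) \<in> L2" by (intro L2_diff L2_translate f)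
    have q: "Q t h = Q t \<psi> + Q t (\<lambda>x. h x - \<psi> x)"
      using L2_mult_integrable[OF u test_L2[OF p(1)]] L2_mult_integrable[OF u h]
      by (simp add: Q_def right_diff_distrib scaleR_add_right[symmetric] del: scaleR_add_right)
    have i: "(LINT x|lebesgue. g x * h x) = (LINT x|lebesgue. g x * \<psi> x) + (LINT x|lebesgue. g x * (h x - \<psi> x))"
      using L2_mult_integrable[OF g test_L2[OF p(1)]] L2_mult_integrable[OF g h]
      by (simp add: right_diff_distrib)
    have "norm (Q t (\<lambda>x. h x - \<psi> x)) < d / 3"
      using Qb[OF hp elim(2)] small by (simp add: c_def)
    moreover have "norm (LINT x|lebesgue. g x * (h x - \<psi> x)) < d / 3"
      using L2_Cauchy_Schwarz[OF g hp] small by (simp add: c_def)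
    moreover have "norm (Q t h - (LINT x|lebesgue. g x * h x))
        \<le> norm (Q t \<psi> - (LINT x|lebesgue. g x * \<psi> x)) + norm (Q t (\<lambda>x. h x - \<psi> x))
          + norm (LINT x|lebesgue. g x * (h x - \<psi> x))"
      unfolding q i
      using norm_triangle_ineq4[of "Q t \<psi> - (LINT x|lebesgue. g x * \<psi> x) + Q t (\<lambda>x. h x - \<psi> x)"
          "LINT x|lebesgue. g x * (h x - \<psi> x)"]
        norm_triangle_ineq[of "Q t \<psi> - (LINT x|lebesgue. g x * \<psi> x)" "Q t (\<lambda>x. h x - \<psi> x)"]
      by (simp add: algebra_simps)
    ultimately show ?case using elim(1) by (simp add: dist_norm)
  qed
qed

text \<open>Translating the integrand gives \<open>a (-t) = cnj (a t) + t cnj (b t)\<close> for the functions \<open>a\<close> and \<open>b\<close>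
  of the proof; the identity is the derivative of this relation at \<open>t = 0\<close>.\<close>

lemma weak_integration_by_parts:
  fixes f g :: "real ^ 'n \<Rightarrow> complex"
  assumes f: "f \<in> L2" and g: "g \<in> L2" and w: "has_weak_partial f j g"
    and k: "(\<lambda>x. of_real (x $ j) * f x) \<in> L2"
  shows "(l2_norm f)\<^sup>2 = - 2 * Re (LINT x|lebesgue. of_real (x $ j) * f x * cnj (g x))"
proof -
  let ?e = "axis j 1 :: real ^ 'n"
  let ?k = "\<lambda>x. of_real (x $ j) * f x"
  define a where "a t = (LINT x|lebesgue. f (x + t *\<^sub>R ?e) * cnj (?k x))" for t
  define b where "b t = (LINT x|lebesgue. f (x + t *\<^sub>R ?e) * cnj (f x))" for t
  define G where "G = (LINT x|lebesgue. g x * cnj (?k x))"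
  have a': "(a has_vector_derivative G) (at 0)"
    unfolding a_def G_def by (rule translate_weak_derivative[OF f g w L2_cnj[OF k]])
  have b': "(b has_vector_derivative (LINT x|lebesgue. g x * cnj (f x))) (at 0)"
    unfolding b_def by (rule translate_weak_derivative[OF f g w L2_cnj[OF f]])
  have ft: "(\<lambda>x. f (x + t *\<^sub>R ?e)) \<in> L2" for t by (rule L2_translate[OF f])
  have key: "a (- t) = cnj (a t) + t *\<^sub>R cnj (b t)" for t
  proof -
    have "a (- t) = (LINT x|lebesgue. f (x + t *\<^sub>R ?e + (- t) *\<^sub>R ?e) * cnj (?k (x + t *\<^sub>R ?e)))"
      unfolding a_def
      by (rule integral_translate[OF borel_measurable_integrable[OF L2_mult_integrable[OF ft L2_cnj[OF k]]], symmetric])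
    \<comment> \<open>The translated weight is \<open>x $ j + t\<close>. The summand
      \<open>x $ j\<close> joins the untranslated factor and yields \<open>cnj (a t)\<close>; the
      summand t yields the term with b.\<close>
    also have "\<dots> = (LINT x|lebesgue. cnj (f (x + t *\<^sub>R ?e) * cnj (?k x)) + of_real t * cnj (f (x + t *\<^sub>R ?e) * cnj (f x)))"
      by (intro Bochner_Integration.integral_cong refl) (simp add: algebra_simps)
    also have "\<dots> = (LINT x|lebesgue. cnj (f (x + t *\<^sub>R ?e) * cnj (?k x)))
        + of_real t * (LINT x|lebesgue. cnj (f (x + t *\<^sub>R ?e) * cnj (f x)))"
      using L2_mult_integrable[OF ft[of t] L2_cnj[OF k]] L2_mult_integrable[OF ft[of t] L2_cnj[OF f]]
      by (subst Bochner_Integration.integral_add) (simp_all del: complex_cnj_mult)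
    also have "\<dots> = cnj (a t) + t *\<^sub>R cnj (b t)"
      using L2_mult_integrable[OF ft[of t] L2_cnj[OF k]] L2_mult_integrable[OF ft[of t] L2_cnj[OF f]]
      by (simp add: a_def b_def scaleR_conv_of_real del: complex_cnj_mult)
    finally show ?thesis .
  qed
  have cnj': "((\<lambda>t. cnj (u t)) has_vector_derivative cnj D) (at 0)" if "(u has_vector_derivative D) (at 0)" for u D
    using bounded_linear.has_vector_derivative[OF bounded_linear_cnj that] .
  \<comment> \<open>At t = 0 the product rule leaves only \<open>cnj (b 0)\<close>, and b 0 is
    ||f||^2.\<close>
  have "((\<lambda>t. t *\<^sub>R cnj (b t)) has_vector_derivative cnj (b 0)) (at 0)"
    using has_vector_derivative_scaleR[OF DERIV_ident cnj'[OF b']] by simp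
  from has_vector_derivative_add[OF cnj'[OF a'] this]
  have "((\<lambda>t. a (- t)) has_vector_derivative cnj G + cnj (b 0)) (at 0)"
    by (simp add: key)
  moreover have "((a \<circ> uminus) has_vector_derivative (- 1) *\<^sub>R G) (at 0)"
    by (rule vector_diff_chain_at) (auto intro!: derivative_eq_intros a')
  \<comment> \<open>Two computations of the derivative of \<open>a (- t)\<close> at 0; the real
    parts give the identity.\<close>
  ultimately have "cnj G + cnj (b 0) = - G"
    by (auto simp: comp_def intro: vector_derivative_unique_at)
  then have "Re (b 0) = - 2 * Re G"
    by (simp add: complex_eq_iff)
  moreover have "b 0 = of_real ((l2_norm f)\<^sup>2)"
    unfolding l2_norm_sq integral_complex_of_real[symmetric] complex_norm_square b_def by simp
  moreover have "Re G = Re (LINT x|lebesgue. ?k x * cnj (g x))"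
  proof -
    have "G = (LINT x|lebesgue. cnj (?k x * cnj (g x)))"
      unfolding G_def by (intro Bochner_Integration.integral_cong refl) simp
    also have "\<dots> = cnj (LINT x|lebesgue. ?k x * cnj (g x))"
      by (rule integral_bounded_linear[OF bounded_linear_cnj L2_mult_integrable[OF k L2_cnj[OF g]]])
    finally show ?thesis by simp
  qed
  ultimately show ?thesis by simp
qed

text \<open>\<open>weak_partial\<close> is a choice, so a derivative found by computation has to be
  identified with it. The difference of two candidates is orthogonal to all test functions.\<close>

lemma weak_partial_unique:
  assumes "g \<in> L2" "has_weak_partial f j g" "g' \<in> L2" "has_weak_partial f j g'"
  shows "g =\<^sub>a\<^sub>e g'"
proof -
  have "(\<lambda>x. g x - g' x) =\<^sub>a\<^sub>e (\<lambda>_. 0)"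
  proof (rule test_orthogonal_imp_zero[OF L2_diff[OF assms(1,3)]])
    fix \<psi> :: "real ^ 'a \<Rightarrow> complex" assume p: "\<psi> \<in> test_functions"
    show "(LINT x|lebesgue. (g x - g' x) * \<psi> x) = 0"
      using assms(2,4) p L2_mult_integrable[OF assms(1) test_L2[OF p]] L2_mult_integrable[OF assms(3) test_L2[OF p]]
      by (simp add: has_weak_partial_def left_diff_distrib)
  qed
  then show ?thesis by simp
qed

subsection \<open>Functions with vanishing gradient\<close>

text \<open>The exceptional null set depends on y. Fubini, for a Borel representative f' so that the
  relation is jointly measurable, exchanges the quantifiers and yields one x with f' (x + y) = f' x
  for almost every y; shifting back by x gives the constant f' x.\<close>

lemma translation_invariant_imp_const:
  fixes f :: "'a::euclidean_space \<Rightarrow> complex"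
  assumes m: "f \<in> borel_measurable lebesgue" and inv: "\<And>y. AE x in lebesgue. f (x + y) = f x"
  shows "\<exists>c. f =\<^sub>a\<^sub>e (\<lambda>_. c)"
proof -
  obtain f' where [measurable]: "f' \<in> borel_measurable lborel" and ae': "AE x in lborel. f x = f' x"
    by (rule completion_ex_borel_measurable_complex[OF m])
  have ae: "f =\<^sub>a\<^sub>e f'" using ae' by (rule AE_completion)
  have inv': "AE x in lborel. f' (x + y) = f' x" for y
  proof -
    have "AE x in lebesgue. f' (x + y) = f' x"
      using inv[of y] ae AE_translate[OF ae, of y] by eventually_elim simp
    then show ?thesis by (simp add: AE_completion_iff)
  qed
  have "AE y in lborel. AE x in lborel. f' (x + y) = f' x"
    using inv' by simp
  then have "AE x in lborel. AE y in lborel. f' (x + y) = f' x"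
    by (subst lborel_pair.AE_commute) measurable
  then obtain x where x: "AE y in lborel. f' (x + y) = f' x"
    using eventually_happens'[of "ae_filter (lborel :: 'a measure)"] by (auto simp: ae_filter_eq_bot_iff)
  have "AE y in lebesgue. f' (x + y) = f' x" using x by (rule AE_completion)
  from AE_translate[OF this, of "- x"] have "AE y in lebesgue. f' y = f' x" by simp
  then have "f =\<^sub>a\<^sub>e (\<lambda>_. f' x)"
    using ae by eventually_elim simp
  then show ?thesis ..
qed

text \<open>The pairing of f with a translate of \<psi> along an axis has derivative zero in the
  shift. Such moves, one axis after another, compose to every vector, and f (x + y) - f x is then
  orthogonal to all test functions.\<close>

lemma weak_gradient_zero_imp_const:
  fixes f :: "real ^ 'n \<Rightarrow> complex"
  assumes f: "L2_loc f"
    and z: "\<And>j \<psi>. \<psi> \<in> test_functions \<Longrightarrow> (LINT x|lebesgue. f x * partial j \<psi> x) = 0"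
  shows "\<exists>c. f =\<^sub>a\<^sub>e (\<lambda>_. c)"
proof (rule translation_invariant_imp_const[OF L2_loc_measurable[OF f]])
  have one: "(LINT x|lebesgue. f x * \<psi> (x + s *\<^sub>R axis j 1)) = (LINT x|lebesgue. f x * \<psi> x)"
    if p: "\<psi> \<in> test_functions" for \<psi> s j
  proof -
    have "((\<lambda>s. LINT x|lebesgue. f x * \<psi> (x + s *\<^sub>R axis j 1)) has_vector_derivative 0) (at s)" for s
      using integral_mult_test_derivative[OF f p, of j s] z[OF test_translate[OF p, of "s *\<^sub>R axis j 1"], of j]
      by (simp add: partial_translate[OF test_differentiable[OF p]])
    from vector_derivative_Lipschitz[OF this, of 0 s 0] show ?thesis by simp
  qed
  have many: "(LINT x|lebesgue. f x * \<psi> (x + (\<Sum>j\<in>J. (y $ j) *\<^sub>R axis j 1))) = (LINT x|lebesgue. f x * \<psi> x)"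
    if "finite J" "\<psi> \<in> test_functions" for J \<psi> and y :: "real ^ 'n"
    using that
  proof (induction J arbitrary: \<psi>)
    case (insert j J)
    have "(LINT x|lebesgue. f x * \<psi> (x + (\<Sum>j\<in>insert j J. (y $ j) *\<^sub>R axis j 1)))
        = (LINT x|lebesgue. f x * \<psi> (x + (\<Sum>j\<in>J. (y $ j) *\<^sub>R axis j 1) + (y $ j) *\<^sub>R axis j 1))"
      using insert.hyps by (simp add: algebra_simps)
    also have "\<dots> = (LINT x|lebesgue. f x * \<psi> (x + (y $ j) *\<^sub>R axis j 1))"
      by (rule insert.IH[OF test_translate[OF insert.prems]])
    also have "\<dots> = (LINT x|lebesgue. f x * \<psi> x)"
      by (rule one[OF insert.prems])
    finally show ?case .
  qed simp
  have all: "(LINT x|lebesgue. f x * \<psi> (x + y)) = (LINT x|lebesgue. f x * \<psi> x)"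
    if "\<psi> \<in> test_functions" for \<psi> y
    using many[OF finite[of UNIV] that, of y] basis_expansion[of y] by (simp add: scalar_mult_eq_scaleR)
  fix y :: "real ^ 'n"
  have "(\<lambda>x. f (x + y) - f x) =\<^sub>a\<^sub>e (\<lambda>_. 0)"
  proof (rule L2_loc_orthogonal_imp_zero[OF L2_loc_diff[OF L2_loc_translate[OF f] f]])
    fix \<psi> :: "real ^ 'n \<Rightarrow> complex" assume p: "\<psi> \<in> test_functions"
    have "(LINT x|lebesgue. f (x + y) * \<psi> x) = (LINT x|lebesgue. f x * \<psi> (x + (- y)))"
      using integral_translate[OF borel_measurable_integrable[OF
          L2_loc_mult_test(2)[OF f test_translate[OF p, of "- y"]]], of y] by simp
    also have "\<dots> = (LINT x|lebesgue. f x * \<psi> x)" by (rule all[OF p])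
    finally show "(LINT x|lebesgue. (f (x + y) - f x) * \<psi> x) = 0"
      using L2_loc_mult_test(2)[OF L2_loc_translate[OF f] p] L2_loc_mult_test(2)[OF f p]
      by (simp add: left_diff_distrib)
  qed
  then show "AE x in lebesgue. f (x + y) = f x" by simp
qed

subsection \<open>Gaussian functions\<close>

lemma nn_integral_gaussian_real:
  assumes "0 < a"
  shows "(\<integral>\<^sup>+t. ennreal (exp (- (a * t\<^sup>2))) \<partial>lborel) = ennreal (sqrt (pi / a))"
proof -
  \<comment> \<open>The standard deviation for which
    \<open>t\<^sup>2 / (2 * \<sigma>\<^sup>2)\<close> is \<open>a * t\<^sup>2\<close>; the integrand
    is then a multiple of a normal density.\<close>
  define \<sigma> where "\<sigma> = 1 / sqrt (2 * a)"
  have s: "0 < \<sigma>" "2 * \<sigma>\<^sup>2 = 1 / a"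
    using assms by (auto simp: \<sigma>_def power_divide field_simps)
  have e: "exp (- (a * t\<^sup>2)) = sqrt (pi / a) * normal_density 0 \<sigma> t" for t
  proof -
    have "2 * pi * \<sigma>\<^sup>2 = pi / a" using s(2) by (simp add: field_simps)
    moreover have "t\<^sup>2 / (2 * \<sigma>\<^sup>2) = a * t\<^sup>2" unfolding s(2) by simp
    ultimately show ?thesis using assms by (simp add: normal_density_def)
  qed
  have "(\<integral>\<^sup>+t. ennreal (exp (- (a * t\<^sup>2))) \<partial>lborel) = ennreal (LINT t|lborel. sqrt (pi / a) * normal_density 0 \<sigma> t)"
    unfolding e using assms s(1)
    by (intro nn_integral_eq_integral Bochner_Integration.integrable_mult_right integrable_normal_density) auto
  then show ?thesis using s(1) by simp
qed

lemma nn_integral_gaussian: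
  assumes "0 < a"
  shows "(\<integral>\<^sup>+x. ennreal (exp (- (a * (norm (x :: real ^ 'n))\<^sup>2))) \<partial>lborel) = ennreal (sqrt (pi / a) ^ CARD('n))"
proof -
  have "(norm x)\<^sup>2 = (\<Sum>b\<in>Basis. (x \<bullet> b)\<^sup>2)" for x :: "real ^ 'n"
    using euclidean_inner[of x x] by (simp add: power2_norm_eq_inner power2_eq_square[of "_ \<bullet> _"])
  then have e: "ennreal (exp (- (a * (norm x)\<^sup>2))) = (\<Prod>b\<in>Basis. ennreal (exp (- (a * (x \<bullet> b)\<^sup>2))))" for x :: "real ^ 'n"
    by (simp add: prod_ennreal exp_sum[symmetric] sum_distrib_left sum_negf)
  have "(\<integral>\<^sup>+x. ennreal (exp (- (a * (norm (x :: real ^ 'n))\<^sup>2))) \<partial>lborel)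
      = (\<Prod>b\<in>(Basis :: (real ^ 'n) set). \<integral>\<^sup>+t. ennreal (exp (- (a * t\<^sup>2))) \<partial>lborel)"
    unfolding e by (rule nn_integral_lborel_prod) auto
  also have "\<dots> = ennreal (sqrt (pi / a) ^ CARD('n))"
    using assms unfolding nn_integral_gaussian_real[OF assms] by (simp add: ennreal_power)
  finally show ?thesis .
qed

lemma continuous_gauss: "continuous_on UNIV (gauss w)"
  using C_k_continuous[OF C_k_gauss] .

lemma norm_gauss_sq: "(norm (gauss w x))\<^sup>2 = exp (- (- Re w * (norm x)\<^sup>2))"
  by (simp add: gauss_def exp_double[symmetric])

lemma gauss_mult_inverse: "gauss w x * gauss (- w) x = 1"
  by (simp add: gauss_def exp_add[symmetric])

text \<open>|gauss w|^2 = exp (Re w |x|^2) has integral u^(-n/2) with u = - Re w / pi, so the norm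
  is u^(-n/4). The product form lets the normalising factor of (iii) cancel directly.\<close>

lemma
  assumes w: "Re w < 0"
  shows gauss_L2: "(gauss w :: real ^ 'n \<Rightarrow> complex) \<in> L2"
    and l2_norm_gauss: "l2_norm (gauss w :: real ^ 'n \<Rightarrow> complex) * (- Re w / pi) powr (real CARD('n) / 4) = 1"
proof -
  let ?G = "gauss w :: real ^ 'n \<Rightarrow> complex"
  let ?r = "sqrt (pi / (- Re w)) ^ CARD('n)"
  have m: "?G \<in> borel_measurable lebesgue"
    by (rule borel_measurable_lebesgue_continuous[OF continuous_gauss])
  have nn: "(\<integral>\<^sup>+x. ennreal ((norm (?G x))\<^sup>2) \<partial>lebesgue) = ennreal ?r"
    unfolding norm_gauss_sq nn_integral_completion using w by (intro nn_integral_gaussian) simp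
  have "has_bochner_integral lebesgue (\<lambda>x. (norm (?G x))\<^sup>2) ?r"
  proof (rule has_bochner_integral_nn_integral[OF _ _ _ nn])
    show "0 \<le> ?r" using w by (intro zero_le_power real_sqrt_ge_zero divide_nonneg_pos) simp_all
  qed (use m in auto)
  then show "?G \<in> L2" and "l2_norm ?G * (- Re w / pi) powr (real CARD('n) / 4) = 1"
  proof -
    assume h: "has_bochner_integral lebesgue (\<lambda>x. (norm (?G x))\<^sup>2) ?r"
    then show "?G \<in> L2" using m by (auto simp: L2_def intro: integrable.intros)
    define u where "u = - Re w / pi"
    have u: "0 < u" using w by (simp add: u_def divide_neg_pos)
    have "pi / (- Re w) = inverse u" by (simp add: u_def)
    then have "?r = sqrt (inverse u) powr real CARD('n)"
      using u by (simp add: powr_realpow)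
    also have "sqrt (inverse u) = u powr (- (1/2))"
      using u by (simp add: powr_half_sqrt[symmetric] powr_minus inverse_powr)
    also have "(u powr (- (1/2))) powr real CARD('n) = u powr (- (real CARD('n) / 2))"
      by (simp add: powr_powr)
    finally have "(l2_norm ?G)\<^sup>2 = u powr (- (real CARD('n) / 2))"
      using has_bochner_integral_integral_eq[OF h] by (simp add: l2_norm_sq)
    also have "\<dots> = (u powr (- (real CARD('n) / 4)))\<^sup>2"
      using u by (simp add: powr_realpow[symmetric] powr_powr)
    finally have "l2_norm ?G = u powr (- (real CARD('n) / 4))"
      by (simp add: power2_eq_iff_nonneg l2_norm_nonneg)
    then show "l2_norm ?G * (- Re w / pi) powr (real CARD('n) / 4) = 1"
      using u unfolding u_def[symmetric] by (simp add: powr_minus)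
  qed
qed

section \<open>Weak derivatives of Gaussians and the equation \<nabla>f = w x f\<close>

lemma partial_mult:
  fixes f g :: "real ^ 'n \<Rightarrow> complex"
  assumes "f differentiable (at x)" "g differentiable (at x)"
  shows "partial j (\<lambda>x. f x * g x) x = f x * partial j g x + partial j f x * g x"
  using partial_eq[OF has_derivative_mult[OF assms[THEN has_derivative_partial]], of j]
  by (simp add: partial_def)

lemma partial_gauss_mult:
  assumes "\<psi> \<in> test_functions"
  shows "partial j (\<lambda>x. gauss w x * \<psi> x) x
    = gauss w x * partial j \<psi> x + w * (of_real (x $ j) * gauss w x) * \<psi> x"
  using partial_mult[OF _ test_differentiable[OF assms], of "gauss w" x j] gauss_has_derivative[of w x]
  by (auto simp: partial_gauss differentiable_def)

text \<open>\<open>gauss w\<close> times \<psi> is a test function, so its partial derivative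
  integrates to zero, and the product rule splits that integral. Compact support of \<psi> makes
  this independent of the sign of Re w.\<close>

lemma gauss_weak_partial:
  fixes w :: complex and j :: "'n::finite"
  shows "has_weak_partial (gauss w) j (\<lambda>x. w * (of_real (x $ j) * gauss w x))"
  unfolding has_weak_partial_def
proof
  fix \<psi> :: "real ^ 'n \<Rightarrow> complex" assume p: "\<psi> \<in> test_functions"
  have l: "L2_loc (gauss w :: real ^ 'n \<Rightarrow> complex)"
    using L2_loc_mult_continuous[OF L2_loc_const[of 1] continuous_gauss[of w]] by simp
  have "continuous_on UNIV (\<lambda>x :: real ^ 'n. w * of_real (x $ j))"
    by (intro continuous_intros)
  from L2_loc_mult_continuous[OF l this]
  have l': "L2_loc (\<lambda>x :: real ^ 'n. w * (of_real (x $ j) * gauss w x))"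
    by (simp add: mult.assoc)
  have "0 = (LINT x|lebesgue. partial j (\<lambda>x. gauss w x * \<psi> x) x)"
    by (rule integral_partial_test[OF test_mult[OF p C_k_gauss], symmetric])
  also have "\<dots> = (LINT x|lebesgue. gauss w x * partial j \<psi> x) + (LINT x|lebesgue. w * (of_real (x $ j) * gauss w x) * \<psi> x)"
    unfolding partial_gauss_mult[OF p]
    by (intro Bochner_Integration.integral_add L2_loc_mult_test(2) l l' p test_partial)
  finally show "(LINT x|lebesgue. w * (of_real (x $ j) * gauss w x) * \<psi> x)
      = - (LINT x|lebesgue. gauss w x * partial j \<psi> x)"
    by (simp add: eq_neg_iff_add_eq_0 add.commute)
qed

lemma has_weak_partial_cmult:
  assumes "has_weak_partial f j g"
  shows "has_weak_partial (\<lambda>x. c * f x) j (\<lambda>x. c * g x)"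
  using assms by (simp add: has_weak_partial_def mult.assoc)

lemma has_weak_partial_AE_cong:
  assumes w: "has_weak_partial f j g" and f: "f =\<^sub>a\<^sub>e f'" and g: "g =\<^sub>a\<^sub>e g'"
    and m: "f \<in> borel_measurable lebesgue" "g \<in> borel_measurable lebesgue"
  shows "has_weak_partial f' j g'"
  unfolding has_weak_partial_def
proof
  fix \<psi> :: "real ^ 'a \<Rightarrow> complex" assume p: "\<psi> \<in> test_functions"
  have e: "(LINT x|lebesgue. h x * \<eta> x) = (LINT x|lebesgue. h' x * \<eta> x)"
    if "h =\<^sub>a\<^sub>e h'" "h \<in> borel_measurable lebesgue" "\<eta> \<in> test_functions" for h h' \<eta> :: "real ^ 'a \<Rightarrow> complex"
  proof (rule integral_cong_AE)
    show "AE x in lebesgue. h x * \<eta> x = h' x * \<eta> x"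
      using that(1) by eventually_elim simp
    show "(\<lambda>x. h x * \<eta> x) \<in> borel_measurable lebesgue"
      by (intro borel_measurable_times test_measurable that)
    show "(\<lambda>x. h' x * \<eta> x) \<in> borel_measurable lebesgue"
      by (intro borel_measurable_times test_measurable that borel_measurable_AE[OF that(2,1)])
  qed
  show "(LINT x|lebesgue. g' x * \<psi> x) = - (LINT x|lebesgue. f' x * partial j \<psi> x)"
    using w p e[OF f m(1) test_partial[OF p]] e[OF g m(2) p] by (simp add: has_weak_partial_def)
qed

text \<open>\<open>gauss (- w)\<close> is an integrating factor. When f is tested against
  \<open>gauss (- w)\<close> times \<psi>, the derivative of the factor cancels the prescribed
  gradient, so the product of f and the factor has weak gradient zero. However fast the factor
  grows, its product with \<psi> is a test function.\<close>

lemma weak_gradient_gauss_imp: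
  fixes f :: "real ^ 'n \<Rightarrow> complex"
  assumes f: "f \<in> L2" and w: "\<And>j. has_weak_partial f j (\<lambda>x. w * (of_real (x $ j) * f x))"
  shows "\<exists>c. f =\<^sub>a\<^sub>e (\<lambda>x. c * gauss w x)"
proof -
  have fl: "L2_loc f" by (rule L2_imp_L2_loc[OF f])
  have "\<exists>c. (\<lambda>x. gauss (- w) x * f x) =\<^sub>a\<^sub>e (\<lambda>_. c)"
  proof (rule weak_gradient_zero_imp_const[OF L2_loc_mult_continuous[OF fl continuous_gauss]])
    fix j :: 'n and \<psi> :: "real ^ 'n \<Rightarrow> complex" assume p: "\<psi> \<in> test_functions"
    let ?E = "gauss (- w) :: real ^ 'n \<Rightarrow> complex"
    have q: "(\<lambda>x. ?E x * \<psi> x) \<in> test_functions" by (rule test_mult[OF p C_k_gauss])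
    have q': "(\<lambda>x. w * of_real (x $ j) * (?E x * \<psi> x)) \<in> test_functions"
      by (rule test_mult[OF q]) (intro C_k_mult C_k_const C_k_coord)
    have q'': "(\<lambda>x. ?E x * partial j \<psi> x) \<in> test_functions"
      by (rule test_mult[OF test_partial[OF p] C_k_gauss])
    have "(LINT x|lebesgue. w * (of_real (x $ j) * f x) * (?E x * \<psi> x))
        = - (LINT x|lebesgue. f x * partial j (\<lambda>x. ?E x * \<psi> x) x)"
      using w q by (auto simp: has_weak_partial_def)
    also have "(LINT x|lebesgue. f x * partial j (\<lambda>x. ?E x * \<psi> x) x)
        = (LINT x|lebesgue. f x * (?E x * partial j \<psi> x) - f x * (w * of_real (x $ j) * (?E x * \<psi> x)))"
      unfolding partial_gauss_mult[OF p]
      by (intro Bochner_Integration.integral_cong refl) (simp add: algebra_simps)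
    also have "\<dots> = (LINT x|lebesgue. f x * (?E x * partial j \<psi> x))
        - (LINT x|lebesgue. f x * (w * of_real (x $ j) * (?E x * \<psi> x)))"
      by (intro Bochner_Integration.integral_diff L2_loc_mult_test(2)[OF fl] q' q'')
    finally show "(LINT x|lebesgue. ?E x * f x * partial j \<psi> x) = 0"
      by (simp add: mult_ac)
  qed
  then obtain c where c: "(\<lambda>x. gauss (- w) x * f x) =\<^sub>a\<^sub>e (\<lambda>_. c)" ..
  have "f =\<^sub>a\<^sub>e (\<lambda>x. c * gauss w x)"
    using c
  proof eventually_elim
    case (elim x)
    have "f x = gauss w x * gauss (- w) x * f x" by (simp add: gauss_mult_inverse)
    also have "\<dots> = c * gauss w x" using elim by (simp add: mult_ac)
    finally show ?case .
  qed
  then show ?thesis ..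
qed

subsection \<open>The uncertainty relation\<close>

lemma weak_partial_M:
  assumes "f \<in> M"
  shows "weak_partial j f \<in> L2" "has_weak_partial f j (weak_partial j f)"
proof -
  have "\<exists>g. g \<in> L2 \<and> has_weak_partial f j g" using assms by (auto simp: M_def)
  from someI_ex[OF this] show "weak_partial j f \<in> L2" "has_weak_partial f j (weak_partial j f)"
    by (auto simp: weak_partial_def)
qed

lemma M_L2: "f \<in> M \<Longrightarrow> f \<in> L2" and M_mult_L2: "f \<in> M \<Longrightarrow> (\<lambda>x. of_real (x $ j) * f x) \<in> L2"
  by (auto simp: M_def)

lemma xmul_L2: "f \<in> M \<Longrightarrow> xmul f \<in> L2"
  by (rule L2_vecI) (simp add: xmul_def M_mult_L2)

lemma wgrad_L2: "f \<in> M \<Longrightarrow> wgrad f \<in> L2"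
  by (rule L2_vecI) (simp add: wgrad_def weak_partial_M)

lemma wgrad_eq_iff:
  "wgrad f =\<^sub>a\<^sub>e (\<lambda>x. w *s xmul f x) \<longleftrightarrow> (\<forall>j. weak_partial j f =\<^sub>a\<^sub>e (\<lambda>x. w * (of_real (x $ j) * f x)))"
  unfolding vec_eq_iff wgrad_def xmul_def by (simp add: AE_all_countable)

text \<open>Forwards, f is c times \<open>gauss w\<close>; the norm of f determines |c|, and
  \<theta> is the argument of c. Backwards, the gradient of the Gaussian is matched with the chosen
  \<open>weak_partial\<close> by uniqueness.\<close>

lemma wgrad_eq_iff_gauss:
  fixes f :: "real ^ 'n \<Rightarrow> complex"
  assumes f: "f \<in> M" and w: "Re w < 0"
  shows "wgrad f =\<^sub>a\<^sub>e (\<lambda>x. w *s xmul f x) \<longleftrightarrow>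
    (\<exists>\<theta>::real. f =\<^sub>a\<^sub>e (\<lambda>x. exp (\<i> * of_real \<theta>) * of_real ((- Re w / pi) powr (real CARD('n) / 4))
      * of_real (l2_norm f) * gauss w x))"
    (is "?L \<longleftrightarrow> ?R")
proof
  assume ?L
  then have "has_weak_partial f j (\<lambda>x. w * (of_real (x $ j) * f x))" for j
    using has_weak_partial_AE_cong[OF weak_partial_M(2)[OF f, of j] _ _ L2_measurable[OF M_L2[OF f]]
      L2_measurable[OF weak_partial_M(1)[OF f, of j]]] by (simp add: wgrad_eq_iff)
  from weak_gradient_gauss_imp[OF M_L2[OF f] this]
  obtain c where c: "f =\<^sub>a\<^sub>e (\<lambda>x. c * gauss w x)" by blast
  let ?u = "(- Re w / pi) powr (real CARD('n) / 4)"
  have "l2_norm f = norm c * l2_norm (gauss w :: real ^ 'n \<Rightarrow> complex)"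
    using l2_norm_AE_cong[OF M_L2[OF f] L2_cmult[OF gauss_L2[OF w]] c] by (simp add: l2_norm_cmult)
  then have "?u * l2_norm f = norm c"
    using l2_norm_gauss[OF w, where 'n='n] by (simp add: mult_ac)
  \<comment> \<open>For c = 0 both sides vanish whatever the argument is, so f = 0 is
    covered.\<close>
  moreover have "c = of_real (norm c) * exp (\<i> * of_real (Arg c))"
    by (cases "c = 0") (simp_all add: Arg_eq)
  ultimately have "c = exp (\<i> * of_real (Arg c)) * of_real ?u * of_real (l2_norm f)"
    by (metis mult.assoc mult.commute of_real_mult)
  with c show ?R by metis
next
  assume ?R
  then obtain c where c: "f =\<^sub>a\<^sub>e (\<lambda>x. c * gauss w x)" by blast
  let ?g = "\<lambda>j x. w * (of_real (x $ j) * f x)"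
  have G: "(\<lambda>x :: real ^ 'n. c * gauss w x) \<in> L2" by (rule L2_cmult[OF gauss_L2[OF w]])
  have "weak_partial j f =\<^sub>a\<^sub>e ?g j" for j
  proof (rule weak_partial_unique[OF weak_partial_M[OF f]])
    show "?g j \<in> L2" by (rule L2_cmult[OF M_mult_L2[OF f]])
    have eq: "?g j =\<^sub>a\<^sub>e (\<lambda>x. c * (w * (of_real (x $ j) * gauss w x)))"
      using c by eventually_elim simp
    then have eq': "(\<lambda>x. c * (w * (of_real (x $ j) * gauss w x))) =\<^sub>a\<^sub>e ?g j"
      by eventually_elim (rule sym)
    have c': "(\<lambda>x. c * gauss w x) =\<^sub>a\<^sub>e f"
      using c by eventually_elim (rule sym)
    show "has_weak_partial f j (?g j)"
      by (rule has_weak_partial_AE_cong[OF has_weak_partial_cmult[OF gauss_weak_partial] c' eq' L2_measurable[OF G]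
          L2_measurable[OF L2_AE_cong[OF L2_cmult[OF M_mult_L2[OF f]] eq]]])
  qed
  then show ?L by (simp add: wgrad_eq_iff)
qed

text \<open>The factor n counts coordinates: \<open>weak_integration_by_parts\<close> contributes
  ||f||^2 once for each j.\<close>

lemma uncertainty_identity:
  fixes f :: "real ^ 'n \<Rightarrow> complex"
  assumes f: "f \<in> M"
  shows "real CARD('n) * (l2_norm f)\<^sup>2 = - 2 * Re (l2_inner (xmul f) (wgrad f))"
proof -
  have "real CARD('n) * (l2_norm f)\<^sup>2 = (\<Sum>j\<in>(UNIV :: 'n set). (l2_norm f)\<^sup>2)" by simp
  also have "\<dots> = (\<Sum>j\<in>UNIV. - 2 * Re (LINT x|lebesgue. of_real (x $ j) * f x * cnj (weak_partial j f x)))"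
    by (intro sum.cong refl weak_integration_by_parts M_L2 weak_partial_M M_mult_L2 f)
  finally show ?thesis
    by (simp add: l2_inner_def xmul_def wgrad_def sum_distrib_left)
qed

section \<open>Complex linear combinations in L2 and the sign function\<close>

lemma scaleR_eq_smult: "r *\<^sub>R v = complex_of_real r *s v" for v :: "complex ^ 'n"
  unfolding vec_eq_iff vector_scaleR_component vector_smult_component by (simp add: scaleR_conv_of_real)

lemma L2_smult:
  fixes f :: "'a::euclidean_space \<Rightarrow> complex ^ 'n"
  assumes "f \<in> L2"
  shows "(\<lambda>x. c *s f x) \<in> L2"
  by (rule L2_vecI) (simp add: L2_cmult L2_vecD[OF assms])

lemma l2_norm_smult:
  fixes f :: "'a::euclidean_space \<Rightarrow> complex ^ 'n"
  shows "l2_norm (\<lambda>x. c *s f x) = norm c * l2_norm f"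
proof -
  have "norm (c *s v) = norm c * norm v" for v :: "complex ^ 'n"
    by (simp add: norm_vec_def norm_mult L2_set_right_distrib)
  then show ?thesis
    unfolding l2_norm_def by (simp add: power_mult_distrib real_sqrt_mult)
qed

text \<open>b enters conjugated because the scalar product is antilinear in its second
  argument.\<close>

lemma l2_norm_smult_add_sq:
  fixes f g :: "'a::euclidean_space \<Rightarrow> complex ^ 'n"
  assumes f: "f \<in> L2" and g: "g \<in> L2"
  shows "(l2_norm (\<lambda>x. a *s f x + b *s g x))\<^sup>2
    = (norm a * l2_norm f)\<^sup>2 + (norm b * l2_norm g)\<^sup>2 + 2 * Re (a * cnj b * l2_inner f g)"
proof -
  have "l2_inner (\<lambda>x. a *s f x) (\<lambda>x. b *s g x) = (\<Sum>j\<in>UNIV. LINT x|lebesgue. (a * cnj b) * (f x $ j * cnj (g x $ j)))"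
    by (simp add: l2_inner_def mult_ac)
  also have "\<dots> = a * cnj b * l2_inner f g"
    by (simp add: l2_inner_def sum_distrib_left)
  finally show ?thesis
    using l2_norm_add_sq[OF L2_smult[OF f, of a] L2_smult[OF g, of b]] by (simp add: l2_norm_smult)
qed

lemma norm_csgn: "norm (csgn z) = 1"
  by (simp add: csgn_def norm_divide)

text \<open>The conjugate sign rotates z onto the nonnegative real axis; this is how |p| arises from
  real parts in (1) and (4).\<close>

lemma cnj_csgn_mult: "cnj (csgn z) * z = of_real (norm z)"
  by (simp add: csgn_def complex_norm_square[symmetric] mult.commute[of "cnj z"] power2_eq_square)

lemma csgn_cnj: "csgn (cnj z) = cnj (csgn z)"
  by (simp add: csgn_def)

lemma Re_csgn: "z \<noteq> 0 \<Longrightarrow> Re (csgn z) = Re z / norm z"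
  by (simp add: csgn_def)

theorem theorem3p1:
  fixes \<phi> :: "real ^ 'n \<Rightarrow> complex"
  assumes "\<phi> \<in> M"
  shows
    "(\<not> xmul \<phi> =\<^sub>a\<^sub>e (\<lambda>_. 0) \<and> \<not> wgrad \<phi> =\<^sub>a\<^sub>e (\<lambda>_. 0) \<longrightarrow>
        real CARD('n) * (l2_norm \<phi>)\<^sup>2 = - 2 * Re (l2_inner (xmul \<phi>) (wgrad \<phi>)) \<and>
        - 2 * Re (l2_inner (xmul \<phi>) (wgrad \<phi>)) =
          l2_norm (xmul \<phi>) * l2_norm (wgrad \<phi>) *
            (2 - (l2_norm (\<lambda>x. xmul \<phi> x /\<^sub>R l2_norm (xmul \<phi>) + wgrad \<phi> x /\<^sub>R l2_norm (wgrad \<phi>)))\<^sup>2) \<and>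
        l2_norm (xmul \<phi>) * l2_norm (wgrad \<phi>) *
            (2 - (l2_norm (\<lambda>x. xmul \<phi> x /\<^sub>R l2_norm (xmul \<phi>) + wgrad \<phi> x /\<^sub>R l2_norm (wgrad \<phi>)))\<^sup>2) =
          (l2_norm (xmul \<phi>))\<^sup>2 + (l2_norm (wgrad \<phi>))\<^sup>2 - (l2_norm (\<lambda>x. xmul \<phi> x + wgrad \<phi> x))\<^sup>2 \<and>
        norm (l2_inner (xmul \<phi>) (wgrad \<phi>)) =
          l2_norm (xmul \<phi>) * l2_norm (wgrad \<phi>) *
            (1 - 1 / 2 * (l2_norm (\<lambda>x. xmul \<phi> x /\<^sub>R l2_norm (xmul \<phi>)
                - csgn (l2_inner (xmul \<phi>) (wgrad \<phi>)) *s (wgrad \<phi> x /\<^sub>R l2_norm (wgrad \<phi>))))\<^sup>2))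
     \<and>
     ((real CARD('n) * (l2_norm \<phi>)\<^sup>2 = (l2_norm (xmul \<phi>))\<^sup>2 + (l2_norm (wgrad \<phi>))\<^sup>2
         \<longleftrightarrow> xmul \<phi> =\<^sub>a\<^sub>e (\<lambda>x. - wgrad \<phi> x)) \<and>
      (xmul \<phi> =\<^sub>a\<^sub>e (\<lambda>x. - wgrad \<phi> x)
         \<longleftrightarrow> (\<exists>\<theta>::real. \<phi> =\<^sub>a\<^sub>e (\<lambda>x.
               exp (\<i> * of_real \<theta>) * of_real (1 / pi powr (real CARD('n) / 4)) * of_real (l2_norm \<phi>)
                 * exp (of_real (- ((norm x)\<^sup>2 / 2)))))))
     \<and>
     (\<not> xmul \<phi> =\<^sub>a\<^sub>e (\<lambda>_. 0) \<longrightarrow>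
       (real CARD('n) * (l2_norm \<phi>)\<^sup>2 = 2 * l2_norm (xmul \<phi>) * l2_norm (wgrad \<phi>)
         \<longleftrightarrow> (\<lambda>x. l2_norm (wgrad \<phi>) *\<^sub>R xmul \<phi> x) =\<^sub>a\<^sub>e (\<lambda>x. - (l2_norm (xmul \<phi>) *\<^sub>R wgrad \<phi> x))) \<and>
       ((\<lambda>x. l2_norm (wgrad \<phi>) *\<^sub>R xmul \<phi> x) =\<^sub>a\<^sub>e (\<lambda>x. - (l2_norm (xmul \<phi>) *\<^sub>R wgrad \<phi> x))
         \<longleftrightarrow> (\<exists>\<theta>::real. \<phi> =\<^sub>a\<^sub>e (\<lambda>x.
               exp (\<i> * of_real \<theta>)
                 * of_real ((l2_norm (wgrad \<phi>) / (pi * l2_norm (xmul \<phi>))) powr (real CARD('n) / 4))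
                 * of_real (l2_norm \<phi>)
                 * exp (of_real (- (l2_norm (wgrad \<phi>) / l2_norm (xmul \<phi>) * ((norm x)\<^sup>2 / 2))))))))
     \<and>
     (\<not> xmul \<phi> =\<^sub>a\<^sub>e (\<lambda>_. 0) \<longrightarrow>
       (norm (l2_inner (xmul \<phi>) (wgrad \<phi>)) = l2_norm (xmul \<phi>) * l2_norm (wgrad \<phi>)
         \<longleftrightarrow> (\<lambda>x. l2_norm (wgrad \<phi>) *\<^sub>R xmul \<phi> x) =\<^sub>a\<^sub>e
             (\<lambda>x. csgn (l2_inner (xmul \<phi>) (wgrad \<phi>)) *s (l2_norm (xmul \<phi>) *\<^sub>R wgrad \<phi> x))) \<and>
       ((\<lambda>x. l2_norm (wgrad \<phi>) *\<^sub>R xmul \<phi> x) =\<^sub>a\<^sub>e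
             (\<lambda>x. csgn (l2_inner (xmul \<phi>) (wgrad \<phi>)) *s (l2_norm (xmul \<phi>) *\<^sub>R wgrad \<phi> x))
         \<longleftrightarrow> (\<exists>\<theta>::real. \<phi> =\<^sub>a\<^sub>e (\<lambda>x.
               exp (\<i> * of_real \<theta>)
                 * of_real ((- Re (csgn (l2_inner (xmul \<phi>) (wgrad \<phi>)))
                      * (l2_norm (wgrad \<phi>) / (pi * l2_norm (xmul \<phi>)))) powr (real CARD('n) / 4))
                 * of_real (l2_norm \<phi>)
                 * exp (csgn (cnj (l2_inner (xmul \<phi>) (wgrad \<phi>)))
                      * of_real (l2_norm (wgrad \<phi>) / l2_norm (xmul \<phi>) * ((norm x)\<^sup>2 / 2)))))) \<and>
       (\<not> wgrad \<phi> =\<^sub>a\<^sub>e (\<lambda>_. 0) \<longrightarrow>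
          Re (l2_inner (xmul \<phi>) (wgrad \<phi>)) = Re (cnj (l2_inner (xmul \<phi>) (wgrad \<phi>))) \<and>
          Re (cnj (l2_inner (xmul \<phi>) (wgrad \<phi>))) = - (real CARD('n) / 2) * (l2_norm \<phi>)\<^sup>2 \<and>
          - (real CARD('n) / 2) * (l2_norm \<phi>)\<^sup>2 < 0 \<and>
          Re (csgn (l2_inner (xmul \<phi>) (wgrad \<phi>))) = Re (csgn (cnj (l2_inner (xmul \<phi>) (wgrad \<phi>)))) \<and>
          Re (csgn (cnj (l2_inner (xmul \<phi>) (wgrad \<phi>)))) < 0))"
proof -
  define X where "X = xmul \<phi>"
  define D where "D = wgrad \<phi>"
  define a where "a = l2_norm X"
  define d where "d = l2_norm D"
  define p where "p = l2_inner X D"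
  define n where "n = real CARD('n)"
  note defs = X_def[symmetric] D_def[symmetric] a_def[symmetric] d_def[symmetric] p_def[symmetric]
    n_def[symmetric]
  have X: "X \<in> L2" and D: "D \<in> L2"
    using assms by (simp_all add: X_def D_def xmul_L2 wgrad_L2)
  have a0: "0 \<le> a" and d0: "0 \<le> d" by (simp_all add: a_def d_def l2_norm_nonneg)
  have n0: "0 < n" by (simp add: n_def)
  have main: "n * (l2_norm \<phi>)\<^sup>2 = - 2 * Re p"
    using uncertainty_identity[OF assms] by (simp add: defs)
  have comb: "(l2_norm (\<lambda>x. \<alpha> *s X x + \<beta> *s D x))\<^sup>2
      = (norm \<alpha> * a)\<^sup>2 + (norm \<beta> * d)\<^sup>2 + 2 * Re (\<alpha> * cnj \<beta> * p)" for \<alpha> \<beta>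
    using l2_norm_smult_add_sq[OF X D] by (simp add: defs)
  \<comment> \<open>Turns each vector equation (ii) into one scalar equation; the equivalences with
    (i) differ only in the choice of coefficients.\<close>
  have comb0: "(\<lambda>x. \<alpha> *s X x + \<beta> *s D x) =\<^sub>a\<^sub>e (\<lambda>_. 0) \<longleftrightarrow>
      (norm \<alpha> * a)\<^sup>2 + (norm \<beta> * d)\<^sup>2 + 2 * Re (\<alpha> * cnj \<beta> * p) = 0" for \<alpha> \<beta>
    unfolding comb[symmetric]
    by (simp add: l2_norm_eq_0_iff[OF L2_add[OF L2_smult[OF X] L2_smult[OF D]]])
  \<comment> \<open>x\<phi> nonzero forces \<phi> nonzero, so Re p < 0 by \<open>main\<close>. A
    vanishing gradient would give p = 0, hence d > 0, and (3) and (4) may divide by a and d.\<close>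
  have pos: "0 < a \<and> 0 < d \<and> Re p < 0 \<and> 0 < (l2_norm \<phi>)\<^sup>2" if "\<not> X =\<^sub>a\<^sub>e (\<lambda>_. 0)"
  proof -
    have a: "0 < a" using that a0 l2_norm_eq_0_iff[OF X] by (simp add: a_def less_le)
    have "\<not> \<phi> =\<^sub>a\<^sub>e (\<lambda>_. 0)"
    proof
      assume "\<phi> =\<^sub>a\<^sub>e (\<lambda>_. 0)"
      then have "X =\<^sub>a\<^sub>e (\<lambda>_. 0)"
        by eventually_elim (simp add: X_def xmul_def vec_eq_iff)
      with that show False by contradiction
    qed
    then have "l2_norm \<phi> \<noteq> 0" using l2_norm_eq_0_iff[OF M_L2[OF assms]] by simp
    then have f: "0 < (l2_norm \<phi>)\<^sup>2" by simp
    then have "0 < n * (l2_norm \<phi>)\<^sup>2" using n0 by simp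
    then have p: "Re p < 0" using main by simp
    have "d \<noteq> 0"
    proof
      assume "d = 0"
      then have "D =\<^sub>a\<^sub>e (\<lambda>_. 0)" using l2_norm_eq_0_iff[OF D] by (simp add: d_def)
      then have "AE x in lebesgue. X x $ j * cnj (D x $ j) = 0" for j
        by eventually_elim simp
      then have "p = 0" unfolding p_def l2_inner_def by (intro sum.neutral ballI integral_eq_zero_AE)
      with p show False by simp
    qed
    with a d0 p f show ?thesis by simp
  qed

  have eq1: "n * (l2_norm \<phi>)\<^sup>2 = - 2 * Re p \<and>
      - 2 * Re p = a * d * (2 - (l2_norm (\<lambda>x. X x /\<^sub>R a + D x /\<^sub>R d))\<^sup>2) \<and>
      a * d * (2 - (l2_norm (\<lambda>x. X x /\<^sub>R a + D x /\<^sub>R d))\<^sup>2)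
        = a\<^sup>2 + d\<^sup>2 - (l2_norm (\<lambda>x. X x + D x))\<^sup>2 \<and>
      norm p = a * d * (1 - 1 / 2 * (l2_norm (\<lambda>x. X x /\<^sub>R a - csgn p *s (D x /\<^sub>R d)))\<^sup>2)"
    if nz: "\<not> X =\<^sub>a\<^sub>e (\<lambda>_. 0)"
  proof -
    have ad: "0 < a" "0 < d" using pos[OF nz] by auto
    have inv: "norm (complex_of_real (inverse a)) * a = 1" "norm (complex_of_real (inverse d)) * d = 1"
      using ad by (simp_all add: norm_inverse)
    have re: "Re (of_real (inverse a) * cnj (of_real (inverse d)) * p) = Re p / (a * d)"
    proof -
      have "of_real (inverse a) * cnj (of_real (inverse d)) * p = of_real (inverse a * inverse d) * p" by simp
      then show ?thesis by (simp add: divide_inverse del: of_real_mult of_real_inverse)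
    qed
    have "(\<lambda>x. X x /\<^sub>R a + D x /\<^sub>R d) = (\<lambda>x. of_real (inverse a) *s X x + of_real (inverse d) *s D x)"
      by (simp only: scaleR_eq_smult)
    \<comment> \<open>Both summands have norm 1, so the squares contribute 2.\<close>
    then have n1: "(l2_norm (\<lambda>x. X x /\<^sub>R a + D x /\<^sub>R d))\<^sup>2 = 2 + 2 * (Re p / (a * d))"
      using comb[of "of_real (inverse a)" "of_real (inverse d)"] inv re by (simp only:) simp
    have n2: "(l2_norm (\<lambda>x. X x + D x))\<^sup>2 = a\<^sup>2 + d\<^sup>2 + 2 * Re p"
      using comb[of 1 1] by simp
    have "(\<lambda>x. X x /\<^sub>R a - csgn p *s (D x /\<^sub>R d))
        = (\<lambda>x. of_real (inverse a) *s X x + (- (csgn p * of_real (inverse d))) *s D x)"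
      by (simp only: scaleR_eq_smult) (simp add: vec_eq_iff fun_eq_iff mult_ac)
    moreover have "norm (- (csgn p * complex_of_real (inverse d))) * d = 1"
      using inv(2) by (simp only: norm_minus_cancel norm_mult norm_csgn mult_1)
    moreover have "Re (of_real (inverse a) * cnj (- (csgn p * of_real (inverse d))) * p) = - (norm p / (a * d))"
    proof -
      have "of_real (inverse a) * cnj (- (csgn p * of_real (inverse d))) * p
          = - (of_real (inverse a * inverse d) * (cnj (csgn p) * p))" by simp
      also have "\<dots> = of_real (- (norm p / (a * d)))"
        unfolding cnj_csgn_mult by (simp add: divide_inverse)
      finally show ?thesis by (simp only: Re_complex_of_real)
    qed
    \<comment> \<open>The unimodular sign factor leaves the summands at norm 1 and turns p into |p|
      in the cross term.\<close>
    ultimately have n3: "(l2_norm (\<lambda>x. X x /\<^sub>R a - csgn p *s (D x /\<^sub>R d)))\<^sup>2 = 2 - 2 * (norm p / (a * d))"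
      using comb[of "of_real (inverse a)" "- (csgn p * of_real (inverse d))"] inv(1) by (simp only:) simp
    show ?thesis
      unfolding n1 n2 n3 using main ad by (simp add: right_diff_distrib)
  qed

  have eq2: "n * (l2_norm \<phi>)\<^sup>2 = a\<^sup>2 + d\<^sup>2 \<longleftrightarrow> X =\<^sub>a\<^sub>e (\<lambda>x. - D x)"
  proof -
    have "X =\<^sub>a\<^sub>e (\<lambda>x. - D x) \<longleftrightarrow> (\<lambda>x. 1 *s X x + 1 *s D x) =\<^sub>a\<^sub>e (\<lambda>_. 0)"
      by (simp add: eq_neg_iff_add_eq_0)
    \<comment> \<open>With coefficients 1 and 1 the expansion is a^2 + d^2 + 2 Re p, and
      \<open>main\<close> rewrites the last term.\<close>
    then show ?thesis unfolding comb0 using main by auto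
  qed
  have eq2b: "X =\<^sub>a\<^sub>e (\<lambda>x. - D x) \<longleftrightarrow> (\<exists>\<theta>::real. \<phi> =\<^sub>a\<^sub>e (\<lambda>x.
      exp (\<i> * of_real \<theta>) * of_real (1 / pi powr (n / 4)) * of_real (l2_norm \<phi>)
        * exp (of_real (- ((norm x)\<^sup>2 / 2)))))"
  proof -
    have "X =\<^sub>a\<^sub>e (\<lambda>x. - D x) \<longleftrightarrow> D =\<^sub>a\<^sub>e (\<lambda>x. (- 1) *s X x)"
      by (intro AE_cong) (auto simp: vec_eq_iff)
    \<comment> \<open>The case w = - 1, where - Re w / pi is 1 / pi.\<close>
    then show ?thesis
      using wgrad_eq_iff_gauss[OF assms, of "- 1"]
      by (simp add: defs gauss_def powr_divide)
  qed

  have eq3: "n * (l2_norm \<phi>)\<^sup>2 = 2 * a * d \<longleftrightarrow> (\<lambda>x. d *\<^sub>R X x) =\<^sub>a\<^sub>e (\<lambda>x. - (a *\<^sub>R D x))"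
    if nz: "\<not> X =\<^sub>a\<^sub>e (\<lambda>_. 0)"
  proof -
    have ad: "0 < a * d" using pos[OF nz] by simp
    have "(\<lambda>x. d *\<^sub>R X x) =\<^sub>a\<^sub>e (\<lambda>x. - (a *\<^sub>R D x)) \<longleftrightarrow>
        (\<lambda>x. of_real d *s X x + of_real a *s D x) =\<^sub>a\<^sub>e (\<lambda>_. 0)"
      by (simp add: eq_neg_iff_add_eq_0 scaleR_eq_smult)
    \<comment> \<open>The weights d and a give both summands norm a d, so the expansion
      factors.\<close>
    also have "\<dots> \<longleftrightarrow> 2 * (a * d) * (a * d + Re p) = 0"
      unfolding comb0 using a0 d0 by (simp add: power2_eq_square algebra_simps)
    also have "\<dots> \<longleftrightarrow> a * d + Re p = 0" using ad by auto
    finally show ?thesis using main by auto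
  qed
  have eq3b: "(\<lambda>x. d *\<^sub>R X x) =\<^sub>a\<^sub>e (\<lambda>x. - (a *\<^sub>R D x)) \<longleftrightarrow> (\<exists>\<theta>::real. \<phi> =\<^sub>a\<^sub>e (\<lambda>x.
      exp (\<i> * of_real \<theta>) * of_real ((d / (pi * a)) powr (n / 4)) * of_real (l2_norm \<phi>)
        * exp (of_real (- (d / a * ((norm x)\<^sup>2 / 2))))))"
    if nz: "\<not> X =\<^sub>a\<^sub>e (\<lambda>_. 0)"
  proof -
    have ad: "0 < a" "0 < d" using pos[OF nz] by auto
    \<comment> \<open>The factor found by solving (ii) for the gradient.\<close>
    let ?w = "complex_of_real (- (d / a))"
    have "d *\<^sub>R x = - (a *\<^sub>R y) \<longleftrightarrow> y = ?w *s x" for x y :: "complex ^ 'n"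
    proof -
      have "d *\<^sub>R x = - (a *\<^sub>R y) \<longleftrightarrow> y = (- (d / a)) *\<^sub>R x"
      proof
        assume "d *\<^sub>R x = - (a *\<^sub>R y)"
        then have "inverse a *\<^sub>R (a *\<^sub>R y) = inverse a *\<^sub>R - (d *\<^sub>R x)" by simp
        then show "y = (- (d / a)) *\<^sub>R x" using ad by (simp add: divide_inverse mult.commute)
      qed (use ad in simp)
      then show ?thesis by (simp only: scaleR_eq_smult)
    qed
    then have "(\<lambda>x. d *\<^sub>R X x) =\<^sub>a\<^sub>e (\<lambda>x. - (a *\<^sub>R D x)) \<longleftrightarrow> D =\<^sub>a\<^sub>e (\<lambda>x. ?w *s X x)"
      by simp
    also have "\<dots> \<longleftrightarrow> (\<exists>\<theta>::real. \<phi> =\<^sub>a\<^sub>e (\<lambda>x. exp (\<i> * of_real \<theta>)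
        * of_real ((- Re ?w / pi) powr (n / 4)) * of_real (l2_norm \<phi>) * gauss ?w x))"
      using wgrad_eq_iff_gauss[OF assms, of ?w] ad by (simp add: defs)
    also have "- Re ?w / pi = d / (pi * a)" by simp
    finally show ?thesis by (simp only: gauss_def of_real_mult[symmetric] mult_minus_left)
  qed

  have eq4: "norm p = a * d \<longleftrightarrow> (\<lambda>x. d *\<^sub>R X x) =\<^sub>a\<^sub>e (\<lambda>x. csgn p *s (a *\<^sub>R D x))"
    if nz: "\<not> X =\<^sub>a\<^sub>e (\<lambda>_. 0)"
  proof -
    have ad: "0 < a * d" using pos[OF nz] by simp
    have "d *\<^sub>R x = csgn p *s (a *\<^sub>R y) \<longleftrightarrow> of_real d *s x + (- (csgn p * of_real a)) *s y = 0"
      for x y :: "complex ^ 'n"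
      by (simp only: scaleR_eq_smult) (simp add: vec_eq_iff mult_ac)
    then have "(\<lambda>x. d *\<^sub>R X x) =\<^sub>a\<^sub>e (\<lambda>x. csgn p *s (a *\<^sub>R D x)) \<longleftrightarrow>
        (\<lambda>x. of_real d *s X x + (- (csgn p * of_real a)) *s D x) =\<^sub>a\<^sub>e (\<lambda>_. 0)"
      by simp
    \<comment> \<open>Both summands again have norm a d, and the sign factor makes the cross term -
      2 a d |p|.\<close>
    also have "\<dots> \<longleftrightarrow> 2 * (a * d) * (a * d - norm p) = 0"
    proof -
      have "of_real d * cnj (- (csgn p * of_real a)) * p = - (of_real (d * a) * (cnj (csgn p) * p))" by simp
      then have "of_real d * cnj (- (csgn p * of_real a)) * p = complex_of_real (- (d * a * norm p))"
        unfolding cnj_csgn_mult by simp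
      moreover have "norm (- (csgn p * complex_of_real a)) = a" "norm (complex_of_real d) = d"
        using a0 d0 by (simp_all add: norm_mult norm_csgn)
      ultimately show ?thesis
        unfolding comb0 by (simp only: Re_complex_of_real) (simp add: power2_eq_square algebra_simps)
    qed
    also have "\<dots> \<longleftrightarrow> norm p = a * d" using ad by auto
    finally show ?thesis by auto
  qed
  have eq4b: "(\<lambda>x. d *\<^sub>R X x) =\<^sub>a\<^sub>e (\<lambda>x. csgn p *s (a *\<^sub>R D x)) \<longleftrightarrow> (\<exists>\<theta>::real. \<phi> =\<^sub>a\<^sub>e (\<lambda>x.
      exp (\<i> * of_real \<theta>) * of_real ((- Re (csgn p) * (d / (pi * a))) powr (n / 4)) * of_real (l2_norm \<phi>)
        * exp (csgn (cnj p) * of_real (d / a * ((norm x)\<^sup>2 / 2)))))"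
    if nz: "\<not> X =\<^sub>a\<^sub>e (\<lambda>_. 0)"
  proof -
    have ad: "0 < a" "0 < d" and p: "Re p < 0" using pos[OF nz] by auto
    \<comment> \<open>The inverse of the unimodular \<open>csgn p\<close> is its conjugate
      \<open>csgn (cnj p)\<close>; Re w < 0 follows from Re p < 0.\<close>
    let ?w = "csgn (cnj p) * complex_of_real (d / a)"
    have s: "cnj (csgn p) * csgn p = 1"
      using complex_norm_square[of "csgn p"] by (simp add: norm_csgn mult.commute)
    have "p \<noteq> 0" using p by auto
    then have "Re (csgn p) < 0" using p by (simp add: Re_csgn divide_neg_pos)
    then have w: "Re ?w < 0" using ad by (simp add: csgn_cnj mult_neg_pos divide_neg_pos)
    have "d *\<^sub>R x = csgn p *s (a *\<^sub>R y) \<longleftrightarrow> y = ?w *s x" for x y :: "complex ^ 'n"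
    proof -
      have "of_real d * u = csgn p * (of_real a * v) \<longleftrightarrow> v = ?w * u" for u v :: complex
      proof
        assume h: "of_real d * u = csgn p * (of_real a * v)"
        have "?w * u = cnj (csgn p) * (of_real d * u) / of_real a" by (simp add: csgn_cnj)
        also have "\<dots> = (cnj (csgn p) * csgn p) * v" unfolding h using ad by simp
        finally show "v = ?w * u" unfolding s by simp
      next
        assume "v = ?w * u"
        then have "csgn p * (of_real a * v) = (cnj (csgn p) * csgn p) * of_real d * u"
          using ad by (simp add: csgn_cnj)
        then show "of_real d * u = csgn p * (of_real a * v)" unfolding s by simp
      qed
      then show ?thesis
        unfolding scaleR_eq_smult vec_eq_iff vector_smult_component by (simp only:)
    qed
    then have "(\<lambda>x. d *\<^sub>R X x) =\<^sub>a\<^sub>e (\<lambda>x. csgn p *s (a *\<^sub>R D x)) \<longleftrightarrow> D =\<^sub>a\<^sub>e (\<lambda>x. ?w *s X x)"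
      by simp
    also have "\<dots> \<longleftrightarrow> (\<exists>\<theta>::real. \<phi> =\<^sub>a\<^sub>e (\<lambda>x. exp (\<i> * of_real \<theta>)
        * of_real ((- Re ?w / pi) powr (n / 4)) * of_real (l2_norm \<phi>) * gauss ?w x))"
      using wgrad_eq_iff_gauss[OF assms w] by (simp add: defs)
    also have "- Re ?w / pi = - Re (csgn p) * (d / (pi * a))"
      by (simp add: csgn_cnj)
    finally show ?thesis by (simp only: gauss_def of_real_mult mult.assoc)
  qed
  have eq5: "Re p = Re (cnj p) \<and> Re (cnj p) = - (n / 2) * (l2_norm \<phi>)\<^sup>2 \<and>
      - (n / 2) * (l2_norm \<phi>)\<^sup>2 < 0 \<and> Re (csgn p) = Re (csgn (cnj p)) \<and> Re (csgn (cnj p)) < 0"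
    if nz: "\<not> X =\<^sub>a\<^sub>e (\<lambda>_. 0)"
  proof -
    have p: "Re p < 0" "p \<noteq> 0" using pos[OF nz] by auto
    have "Re p = - (n / 2) * (l2_norm \<phi>)\<^sup>2" using main by simp
    with p show ?thesis by (simp add: csgn_cnj Re_csgn divide_neg_pos)
  qed
  show ?thesis
    unfolding defs using eq1 eq2 eq2b eq3 eq3b eq4 eq4b eq5 by blast
qed

end
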